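(* Let $M\in\mathbb{R}^{n\times n}$ and $q\in\mathbb{R}^n$. Given any $x^0\in\mathbb{R}^n$ with $x^0\ge 0$, the following inverse problem ILCP(a) of the linear complementarity problem with data $(M,q)$, $$\min\ \|M-M'\|_f^2+\|q-q'\|^2\quad\text{s.t.}\quad s=M'x^0+q',\quad (x^0)^Ts=0,\quad s\ge 0$$ in the variables $M'\in\mathbb{R}^{n\times n}$, $q'\in\mathbb{R}^n$, $s\in\mathbb{R}^n$, can be solved in polynomial time.
   Context: The linear complementarity problem (LCP) with data $(M,q)$ is to find $(x,s)\in\mathbb{R}^n\times\mathbb{R}^n$ with $s=Mx+q$, $x\ge 0$, $s\ge 0$, $x^Ts=0$; equivalently, formulated as an optimization problem, to minimize $x^Ts$ subject to $s=Mx+q$, $x,s\ge 0$. It is called monotone if $M$ (not necessarily symmetric) is positive semidefinite and non-monotone otherwise; $M$ is not assumed positive semidefinite here. $\|B\|_f=\sqrt{\sum_{i,j}B_{ij}^2}$ is the Frobenius norm and $\|\cdot\|$ is the Euclidean norm. Vector inequalities are componentwise. ILCP(a) is the inverse problem in the case where only $x^0\ge 0$ is given: find $M'$, $q'$ closest to $M$, $q$ and some $s^0\ge 0$ such that $(x^0,s^0)$ is an optimal solution of the LCP with data $(M',q')$. The input of the problem is $(M,q,x^0)$. *)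

theory Defs
  imports
    Complex_Main
    "HOL-Computational_Algebra.Polynomial"
    "HOL-Library.Log_Nat"
    "Jordan_Normal_Form.Matrix"
begin

section \<open>The inverse problem ILCP(a)\<close>

definition frobenius_norm :: "real mat \<Rightarrow> real" where
  "frobenius_norm B = sqrt (\<Sum>i<dim_row B. \<Sum>j<dim_col B. (B $$ (i, j))\<^sup>2)"

definition euclidean_norm :: "real vec \<Rightarrow> real" where
  "euclidean_norm v = sqrt (v \<bullet> v)"

type_synonym 'a ilcp_point = "'a mat \<times> 'a vec \<times> 'a vec"

fun ilcp_a_feasible :: "nat \<Rightarrow> real vec \<Rightarrow> real ilcp_point \<Rightarrow> bool" where
  "ilcp_a_feasible n x0 (M', q', s) \<longleftrightarrow>
     M' \<in> carrier_mat n n \<and> q' \<in> carrier_vec n \<and> s \<in> carrier_vec n \<and>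
     s = M' *\<^sub>v x0 + q' \<and> x0 \<bullet> s = 0 \<and> 0\<^sub>v n \<le> s"

fun ilcp_a_objective :: "real mat \<Rightarrow> real vec \<Rightarrow> real ilcp_point \<Rightarrow> real" where
  "ilcp_a_objective M q (M', q', s) = (frobenius_norm (M - M'))\<^sup>2 + (euclidean_norm (q - q'))\<^sup>2"

definition ilcp_a_optimal ::
  "nat \<Rightarrow> real mat \<Rightarrow> real vec \<Rightarrow> real vec \<Rightarrow> real ilcp_point \<Rightarrow> bool" where
  "ilcp_a_optimal n M q x0 z \<longleftrightarrow>
     ilcp_a_feasible n x0 z \<and>
     (\<forall>z'. ilcp_a_feasible n x0 z' \<longrightarrow> ilcp_a_objective M q z \<le> ilcp_a_objective M q z')"

section \<open>Random access machines over an ordered field\<close>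

text \<open>A machine has index registers, which hold natural numbers, and a memory of field elements,
  which is addressed through the index registers. The program is one fixed finite list of
  instructions, independent of the dimension and of the data. Index registers cannot be multiplied,
  and there is no conversion from field elements to indices (no rounding), so that unit-cost
  computations over the reals cannot gain power from either.\<close>

record 'a config =
  pc :: nat
  idx :: "nat \<Rightarrow> nat"
  mem :: "nat \<Rightarrow> 'a"

datatype instr =
    SetI nat nat
  | AddI nat nat nat
  | SubI nat nat nat
  | JumpLessI nat nat nat
  | Const nat int
  | Add nat nat nat
  | Sub nat nat nat
  | Mul nat nat nat
  | Div nat nat nat
  | JumpLess nat nat nat

abbreviation cell :: "'a config \<Rightarrow> nat \<Rightarrow> 'a" where
  "cell c k \<equiv> mem c (idx c k)"

abbreviation advance :: "'a config \<Rightarrow> 'a config" where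
  "advance c \<equiv> c\<lparr>pc := Suc (pc c)\<rparr>"

abbreviation store_idx :: "nat \<Rightarrow> nat \<Rightarrow> 'a config \<Rightarrow> 'a config" where
  "store_idx k v c \<equiv> c\<lparr>idx := (idx c)(k := v)\<rparr>"

abbreviation store_cell :: "nat \<Rightarrow> 'a \<Rightarrow> 'a config \<Rightarrow> 'a config" where
  "store_cell k v c \<equiv> c\<lparr>mem := (mem c)(idx c k := v)\<rparr>"

text \<open>Subtraction of indices is truncated at 0, and division by the field element 0 gives 0.\<close>

fun step :: "instr \<Rightarrow> 'a::linordered_field config \<Rightarrow> 'a config" where
  "step (SetI k v) c = advance (store_idx k v c)"
| "step (AddI k a b) c = advance (store_idx k (idx c a + idx c b) c)"
| "step (SubI k a b) c = advance (store_idx k (idx c a - idx c b) c)"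
| "step (JumpLessI a b l) c = (if idx c a < idx c b then c\<lparr>pc := l\<rparr> else advance c)"
| "step (Const k v) c = advance (store_cell k (of_int v) c)"
| "step (Add k a b) c = advance (store_cell k (cell c a + cell c b) c)"
| "step (Sub k a b) c = advance (store_cell k (cell c a - cell c b) c)"
| "step (Mul k a b) c = advance (store_cell k (cell c a * cell c b) c)"
| "step (Div k a b) c = advance (store_cell k (cell c a / cell c b) c)"
| "step (JumpLess a b l) c = (if cell c a < cell c b then c\<lparr>pc := l\<rparr> else advance c)"

text \<open>\<open>exec cost P c t c'\<close>: started in \<open>c\<close>, the program \<open>P\<close> halts in \<open>c'\<close>, at total cost \<open>t\<close>.\<close>

inductive exec ::
  "(instr \<Rightarrow> 'a::linordered_field config \<Rightarrow> nat) \<Rightarrow> instr list \<Rightarrow>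
     'a config \<Rightarrow> nat \<Rightarrow> 'a config \<Rightarrow> bool"
  for cost :: "instr \<Rightarrow> 'a::linordered_field config \<Rightarrow> nat" and P :: "instr list" where
  halt: "length P \<le> pc c \<Longrightarrow> exec cost P c 0 c"
| step: "pc c < length P \<Longrightarrow> exec cost P (step (P ! pc c) c) t c' \<Longrightarrow>
         exec cost P c (cost (P ! pc c) c + t) c'"

definition unit_cost :: "instr \<Rightarrow> 'a config \<Rightarrow> nat" where
  "unit_cost i c = 1"

text \<open>Encoding lengths: \<open>floorlog 2 k\<close> is the number of binary digits of \<open>k\<close>; an integer also has
  a sign bit, and a rational number is stored in lowest terms.\<close>

definition int_size :: "int \<Rightarrow> nat" where
  "int_size z = 1 + floorlog 2 (nat \<bar>z\<bar>)"

definition rat_size :: "rat \<Rightarrow> nat" where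
  "rat_size r = (case quotient_of r of (a, b) \<Rightarrow> int_size a + int_size b)"

text \<open>Logarithmic cost: an instruction is charged the lengths of all operands and addresses it
  uses. A Turing machine performs each instruction on rational numbers in time polynomial in these
  lengths, so polynomial logarithmic cost means polynomial time in the Turing machine model.\<close>

fun log_cost :: "instr \<Rightarrow> rat config \<Rightarrow> nat" where
  "log_cost (SetI k v) c = 1 + floorlog 2 v"
| "log_cost (AddI k a b) c = 1 + floorlog 2 (idx c a) + floorlog 2 (idx c b)"
| "log_cost (SubI k a b) c = 1 + floorlog 2 (idx c a) + floorlog 2 (idx c b)"
| "log_cost (JumpLessI a b l) c = 1 + floorlog 2 (idx c a) + floorlog 2 (idx c b)"
| "log_cost (Const k v) c = 1 + floorlog 2 (idx c k) + int_size v"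
| "log_cost (Add k a b) c = 1 + floorlog 2 (idx c k) + floorlog 2 (idx c a) + floorlog 2 (idx c b)
     + rat_size (cell c a) + rat_size (cell c b)"
| "log_cost (Sub k a b) c = 1 + floorlog 2 (idx c k) + floorlog 2 (idx c a) + floorlog 2 (idx c b)
     + rat_size (cell c a) + rat_size (cell c b)"
| "log_cost (Mul k a b) c = 1 + floorlog 2 (idx c k) + floorlog 2 (idx c a) + floorlog 2 (idx c b)
     + rat_size (cell c a) + rat_size (cell c b)"
| "log_cost (Div k a b) c = 1 + floorlog 2 (idx c k) + floorlog 2 (idx c a) + floorlog 2 (idx c b)
     + rat_size (cell c a) + rat_size (cell c b)"
| "log_cost (JumpLess a b l) c = 1 + floorlog 2 (idx c a) + floorlog 2 (idx c b)
     + rat_size (cell c a) + rat_size (cell c b)"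

text \<open>An input consists of a dimension, placed in index register 0, and a list of field elements,
  placed at the start of the memory.\<close>

definition init_config :: "nat \<Rightarrow> 'a::zero list \<Rightarrow> 'a config" where
  "init_config n xs =
     \<lparr>pc = 0, idx = (\<lambda>k. if k = 0 then n else 0), mem = (\<lambda>i. if i < length xs then xs ! i else 0)\<rparr>"

text \<open>A search problem has a set \<open>D\<close> of instances, an encoding \<open>enc\<close> and a size \<open>len\<close> of instances, and a
  relation \<open>R\<close> saying which final memories represent a correct answer.\<close>

definition solvable_in_poly_time ::
  "(instr \<Rightarrow> 'a::linordered_field config \<Rightarrow> nat) \<Rightarrow> 'i set \<Rightarrow> ('i \<Rightarrow> nat \<times> 'a list) \<Rightarrow> ('i \<Rightarrow> nat) \<Rightarrow>
     ('i \<Rightarrow> (nat \<Rightarrow> 'a) \<Rightarrow> bool) \<Rightarrow> bool" where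
  "solvable_in_poly_time cost D enc len R \<longleftrightarrow>
     (\<exists>(P :: instr list) (p :: nat poly). \<forall>x\<in>D. \<exists>t c.
        exec cost P (case_prod init_config (enc x)) t c \<and> t \<le> poly p (len x) \<and> R x (mem c))"

section \<open>ILCP(a) as a computational problem\<close>

type_synonym 'a ilcp_instance = "nat \<times> 'a mat \<times> 'a vec \<times> 'a vec"

definition ilcp_a_instances :: "'a::linordered_field ilcp_instance set" where
  "ilcp_a_instances = {(n, M, q, x0). 0 < n \<and> M \<in> carrier_mat n n \<and> q \<in> carrier_vec n \<and>
     x0 \<in> carrier_vec n \<and> 0\<^sub>v n \<le> x0}"

text \<open>Matrices are stored row by row.\<close>

definition ilcp_data :: "'a ilcp_instance \<Rightarrow> 'a list" where
  "ilcp_data = (\<lambda>(n, M, q, x0). concat (map list_of_vec (rows M)) @ list_of_vec q @ list_of_vec x0)"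

definition ilcp_encode :: "'a ilcp_instance \<Rightarrow> nat \<times> 'a list" where
  "ilcp_encode x = (fst x, ilcp_data x)"

definition ilcp_size :: "('a \<Rightarrow> nat) \<Rightarrow> 'a ilcp_instance \<Rightarrow> nat" where
  "ilcp_size sz x = (\<Sum>a\<leftarrow>ilcp_data x. sz a)"

text \<open>The output \<open>(M', q', s)\<close> is read from the memory in the layout used for \<open>(M, q, x0)\<close>.\<close>

definition ilcp_decode :: "nat \<Rightarrow> (nat \<Rightarrow> 'a) \<Rightarrow> 'a ilcp_point" where
  "ilcp_decode n m =
     (mat n n (\<lambda>(i, j). m (i * n + j)), vec n (\<lambda>i. m (n * n + i)), vec n (\<lambda>i. m (n * n + n + i)))"

text \<open>The data and the output lie in a field embedded in the reals by \<open>h\<close>; optimality is always with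
  respect to all real \<open>(M', q', s)\<close>.\<close>

definition ilcp_a_answer :: "('a \<Rightarrow> real) \<Rightarrow> 'a ilcp_instance \<Rightarrow> (nat \<Rightarrow> 'a) \<Rightarrow> bool" where
  "ilcp_a_answer h = (\<lambda>(n, M, q, x0) m.
     ilcp_a_optimal n (map_mat h M) (map_vec h q) (map_vec h x0) (ilcp_decode n (h \<circ> m)))"

end

theory Submission
  imports Defs
begin

text \<open>Since \<open>x\<^sup>0, s \<ge> 0\<close>, complementarity holds componentwise and the problem splits into independent
  problems for the rows of \<open>(M', q')\<close>. Let \<open>r\<^sub>i = q\<^sub>i + (M x\<^sup>0)\<^sub>i\<close>. By Cauchy-Schwarz, changing row \<open>i\<close> so that its
  residual becomes \<open>s\<^sub>i\<close> costs at least \<open>(r\<^sub>i - s\<^sub>i)\<^sup>2 / (1 + \<parallel>x\<^sup>0\<parallel>\<^sup>2)\<close>, with equality if the change is a multiple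
  of \<open>(x\<^sup>0, 1)\<close>. The admissible \<open>s\<^sub>i\<close> nearest to \<open>r\<^sub>i\<close> is 0 if \<open>x\<^sup>0\<^sub>i > 0\<close> or \<open>r\<^sub>i < 0\<close>, and \<open>r\<^sub>i\<close> itself otherwise.
  This closed form takes \<open>O(n\<^sup>2)\<close> field operations. Over the rationals no intermediate value is the result of more
  than \<open>O(n)\<close> operations on input numbers, so that all encoding lengths stay polynomial.\<close>

section \<open>The optimal solution\<close>

definition residual :: "nat \<Rightarrow> (nat \<Rightarrow> nat \<Rightarrow> 'a::linordered_field) \<Rightarrow> (nat \<Rightarrow> 'a) \<Rightarrow> (nat \<Rightarrow> 'a) \<Rightarrow> nat \<Rightarrow> 'a" where
  "residual n A q x i = q i + (\<Sum>j<n. A i j * x j)"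

definition slack :: "nat \<Rightarrow> (nat \<Rightarrow> nat \<Rightarrow> 'a::linordered_field) \<Rightarrow> (nat \<Rightarrow> 'a) \<Rightarrow> (nat \<Rightarrow> 'a) \<Rightarrow> nat \<Rightarrow> 'a" where
  "slack n A q x i = (if 0 < x i \<or> residual n A q x i < 0 then 0 else residual n A q x i)"

definition shift :: "nat \<Rightarrow> (nat \<Rightarrow> nat \<Rightarrow> 'a::linordered_field) \<Rightarrow> (nat \<Rightarrow> 'a) \<Rightarrow> (nat \<Rightarrow> 'a) \<Rightarrow> nat \<Rightarrow> 'a" where
  "shift n A q x i = (residual n A q x i - slack n A q x i) / (1 + (\<Sum>j<n. x j * x j))"

lemma one_plus_sum_squares_pos: "0 < 1 + (\<Sum>j<n. x j * x j)" for x :: "nat \<Rightarrow> 'a::linordered_field"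
  by (simp add: add_pos_nonneg sum_nonneg)

text \<open>A positive \<open>x i\<close> forces \<open>s = 0\<close>, which is then the slack as
  well. In the remaining cases either the left side is 0, or the residual is negative and the slack
  0, and then no \<open>s >= 0\<close> is closer.\<close>

lemma slack_residual_dist_le:
  assumes "0 \<le> s" and "x i * s = 0"
  shows "(residual n A q x i - slack n A q x i)\<^sup>2 \<le> (residual n A q x i - s)\<^sup>2"
proof -
  have "\<bar>residual n A q x i - slack n A q x i\<bar> \<le> \<bar>residual n A q x i - s\<bar>"
    using assms by (auto simp: slack_def)
  then show ?thesis by (simp add: abs_le_square_iff)
qed

text \<open>Summing the inequality \<open>a\<^sup>2 \<ge> 2 \<delta> x a - \<delta>\<^sup>2 x\<^sup>2\<close> gives Cauchy-Schwarz for the choice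
  of \<open>\<delta>\<close> that makes the changes of a row proportional to \<open>(x, 1)\<close>.\<close>

lemma row_change_lower_bound:
  fixes a x :: "nat \<Rightarrow> real"
  shows "((\<Sum>j<n. a j * x j) + c)\<^sup>2 / (1 + (\<Sum>j<n. x j * x j)) \<le> (\<Sum>j<n. (a j)\<^sup>2) + c\<^sup>2"
proof -
  define N where "N = 1 + (\<Sum>j<n. x j * x j)"
  define e where "e = (\<Sum>j<n. a j * x j) + c"
  define \<delta> where "\<delta> = e / N"
  have N: "N > 0" unfolding N_def by (rule one_plus_sum_squares_pos)
  have "2 * \<delta> * a j * x j - \<delta>\<^sup>2 * (x j * x j) \<le> (a j)\<^sup>2" for j
    using zero_le_power2[of "a j - \<delta> * x j"] by (simp add: power2_eq_square algebra_simps)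
  then have "(\<Sum>j<n. 2 * \<delta> * a j * x j - \<delta>\<^sup>2 * (x j * x j)) \<le> (\<Sum>j<n. (a j)\<^sup>2)"
    by (intro sum_mono)
  moreover have "(\<Sum>j<n. 2 * \<delta> * a j * x j - \<delta>\<^sup>2 * (x j * x j))
      = 2 * \<delta> * (\<Sum>j<n. a j * x j) - \<delta>\<^sup>2 * (\<Sum>j<n. x j * x j)"
    by (simp add: sum_subtractf sum_distrib_left mult.assoc)
  moreover have "2 * \<delta> * c - \<delta>\<^sup>2 \<le> c\<^sup>2"
    using zero_le_power2[of "c - \<delta>"] by (simp add: power2_eq_square algebra_simps)
  ultimately have "2 * \<delta> * e - \<delta>\<^sup>2 * N \<le> (\<Sum>j<n. (a j)\<^sup>2) + c\<^sup>2"
    by (simp add: e_def N_def algebra_simps)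
  moreover have "2 * \<delta> * e - \<delta>\<^sup>2 * N = e\<^sup>2 / N"
    using N by (simp add: \<delta>_def power2_eq_square field_simps)
  ultimately show ?thesis by (simp add: e_def N_def)
qed

lemma ilcp_a_objective_eq:
  assumes "M \<in> carrier_mat n n" "q \<in> carrier_vec n" "M' \<in> carrier_mat n n" "q' \<in> carrier_vec n"
  shows "ilcp_a_objective M q (M', q', s)
    = (\<Sum>i<n. (\<Sum>j<n. (M $$ (i, j) - M' $$ (i, j))\<^sup>2) + (q $ i - q' $ i)\<^sup>2)"
proof -
  have "(frobenius_norm (M - M'))\<^sup>2 = (\<Sum>i<n. \<Sum>j<n. (M $$ (i, j) - M' $$ (i, j))\<^sup>2)"
    using assms by (simp add: frobenius_norm_def sum_nonneg)
  moreover have "(euclidean_norm (q - q'))\<^sup>2 = (\<Sum>i<n. (q $ i - q' $ i)\<^sup>2)"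
    using assms by (simp add: euclidean_norm_def scalar_prod_def sum_nonneg power2_eq_square lessThan_atLeast0)
  ultimately show ?thesis by (simp add: sum.distrib)
qed

lemma ilcp_a_optimal_projection:
  fixes M :: "real mat" and q x0 :: "real vec"
  assumes M: "M \<in> carrier_mat n n" and q: "q \<in> carrier_vec n"
    and x0: "x0 \<in> carrier_vec n" "0\<^sub>v n \<le> x0"
    and A_def: "A = (\<lambda>i j. M $$ (i, j))"
  shows "ilcp_a_optimal n M q x0
    (mat n n (\<lambda>(i, j). A i j - shift n A (($) q) (($) x0) i * x0 $ j),
     vec n (\<lambda>i. q $ i - shift n A (($) q) (($) x0) i), vec n (slack n A (($) q) (($) x0)))"
    (is "ilcp_a_optimal n M q x0 (?M, ?q, ?s)")
proof -
  let ?x = "($) x0"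
  let ?r = "residual n A (($) q) ?x" and ?\<sigma> = "slack n A (($) q) ?x" and ?\<delta> = "shift n A (($) q) ?x"
  define N where "N = 1 + (\<Sum>j<n. ?x j * ?x j)"
  have N: "N > 0" unfolding N_def by (rule one_plus_sum_squares_pos)
  have x_nonneg: "0 \<le> x0 $ i" if "i < n" for i
    using x0 that by (auto simp: less_eq_vec_def)
  have shift_N: "?\<delta> i * N = ?r i - ?\<sigma> i" for i
    using N by (simp add: shift_def N_def)
  have "?s = ?M *\<^sub>v x0 + ?q"
  proof (intro eq_vecI)
    fix i assume "i < dim_vec (?M *\<^sub>v x0 + ?q)"
    then have i: "i < n" by simp
    \<comment> \<open>Subtracting \<open>?\<delta> i\<close> times \<open>(x0, 1)\<close> from row
      \<open>i\<close> lowers its residual by \<open>?\<delta> i * N\<close>, which leaves exactly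
      the slack.\<close>
    have "(?M *\<^sub>v x0 + ?q) $ i = (\<Sum>j<n. (A i j - ?\<delta> i * x0 $ j) * x0 $ j) + (q $ i - ?\<delta> i)"
      using i x0 by (simp add: scalar_prod_def lessThan_atLeast0)
    also have "\<dots> = ?r i - ?\<delta> i * N"
      by (simp add: residual_def N_def algebra_simps sum_subtractf sum_distrib_left)
    also have "\<dots> = ?s $ i"
      using i by (simp add: shift_N)
    finally show "?s $ i = (?M *\<^sub>v x0 + ?q) $ i" ..
  qed simp
  moreover have "x0 \<bullet> ?s = 0"
    using x_nonneg by (auto simp: scalar_prod_def slack_def less_le intro!: sum.neutral)
  moreover have "0\<^sub>v n \<le> ?s"
    by (auto simp: less_eq_vec_def slack_def)
  ultimately have feasible: "ilcp_a_feasible n x0 (?M, ?q, ?s)"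
    unfolding ilcp_a_feasible.simps by (intro conjI mat_carrier vec_carrier)
  have "ilcp_a_objective M q (?M, ?q, ?s) \<le> ilcp_a_objective M q z" if "ilcp_a_feasible n x0 z" for z
  proof -
    obtain M' q' s where z: "z = (M', q', s)" by (cases z) auto
    with that have M': "M' \<in> carrier_mat n n" and q': "q' \<in> carrier_vec n" and s: "s \<in> carrier_vec n"
      and s_eq: "s = M' *\<^sub>v x0 + q'" and compl: "x0 \<bullet> s = 0" and "0\<^sub>v n \<le> s"
      by auto
    then have s_nonneg: "0 \<le> s $ i" if "i < n" for i
      using that by (auto simp: less_eq_vec_def)
    \<comment> \<open>A sum of nonnegative terms vanishes only if every term does; this turns
      complementarity into a condition on each row separately.\<close>
    have "(\<Sum>i<n. x0 $ i * s $ i) = 0"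
      using compl s by (simp add: scalar_prod_def lessThan_atLeast0)
    then have x_s: "x0 $ i * s $ i = 0" if "i < n" for i
      using that x_nonneg s_nonneg by (subst (asm) sum_nonneg_eq_0_iff) auto
    have "(\<Sum>j<n. (M $$ (i, j) - ?M $$ (i, j))\<^sup>2) + (q $ i - ?q $ i)\<^sup>2
        \<le> (\<Sum>j<n. (M $$ (i, j) - M' $$ (i, j))\<^sup>2) + (q $ i - q' $ i)\<^sup>2" if i: "i < n" for i
    proof -
      \<comment> \<open>The change of the row is \<open>?\<delta> i\<close> times
        \<open>(x0, 1)\<close>, a vector of squared length \<open>N\<close>.\<close>
      have "(\<Sum>j<n. (M $$ (i, j) - ?M $$ (i, j))\<^sup>2) + (q $ i - ?q $ i)\<^sup>2 = (?\<delta> i)\<^sup>2 * N"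
        using i by (simp add: A_def N_def power2_eq_square algebra_simps sum_distrib_left sum_distrib_right)
      also have "\<dots> = (?r i - ?\<sigma> i)\<^sup>2 / N"
        unfolding shift_N[symmetric] using N by (simp add: power2_eq_square)
      also have "\<dots> \<le> (?r i - s $ i)\<^sup>2 / N"
        using N slack_residual_dist_le[OF s_nonneg[OF i], of ?x i n A "($) q"] x_s[OF i]
        by (intro divide_right_mono) auto
      also have "s $ i = (\<Sum>j<n. M' $$ (i, j) * x0 $ j) + q' $ i"
        using i M' q' x0 by (simp add: s_eq scalar_prod_def lessThan_atLeast0)
      \<comment> \<open>The residual is linear in the row, so the difference of two residuals is the
        change of the row applied to \<open>(x0, 1)\<close>. Cauchy-Schwarz bounds exactly
        this.\<close>
      also have "?r i - \<dots> = (\<Sum>j<n. (M $$ (i, j) - M' $$ (i, j)) * x0 $ j) + (q $ i - q' $ i)"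
        by (simp add: residual_def A_def algebra_simps sum_subtractf)
      also have "(\<dots>)\<^sup>2 / N \<le> (\<Sum>j<n. (M $$ (i, j) - M' $$ (i, j))\<^sup>2) + (q $ i - q' $ i)\<^sup>2"
        unfolding N_def by (rule row_change_lower_bound)
      finally show ?thesis .
    qed
    then show ?thesis
      unfolding z using M q M' q' by (auto simp: ilcp_a_objective_eq intro!: sum_mono simp del: ilcp_a_objective.simps)
  qed
  with feasible show ?thesis by (simp add: ilcp_a_optimal_def del: ilcp_a_feasible.simps)
qed

section \<open>The program\<close>

text \<open>Write \<open>b = n\<^sup>2 + 2 n\<close> for the length of the input. The cells \<open>b\<close>, \<open>b + 1\<close> and \<open>b + 2\<close> hold
  \<open>N = 1 + \<parallel>x\<^sup>0\<parallel>\<^sup>2\<close>, the residual of the current row (from line 35 on its shift), and a product; cell \<open>b + 3\<close> stays 0.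
  A copy of \<open>x\<^sup>0\<close> starts at \<open>b + 4\<close>, because the slacks overwrite the original. These addresses are in the
  registers 7, 8, 9, 10 and 13, the end of the copy is in 11; registers 1 and 14 hold 1 and 0. Registers
  3, 4, 5 point to the current entries of \<open>M\<close>, \<open>q\<close> and \<open>s\<close>, registers 6 and 12 into the copy.

  All loops test at the end, which is correct since \<open>n > 0\<close>. Lines 1-3 compute \<open>n\<^sup>2\<close>, lines 14-19 copy
  \<open>x\<^sup>0\<close> and sum \<open>N\<close>, and lines 21-45 treat one row: lines 23-27 form the residual, lines 30-33 the slack, and
  lines 36-40 correct the entries of \<open>M\<close>.\<close>

definition ilcp_program :: "instr list" where
  "ilcp_program = [
    SetI 1 1,
    AddI 4 4 0,
    AddI 2 2 1,
    JumpLessI 2 0 1,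
    AddI 5 4 0,
    AddI 7 5 0,
    AddI 8 7 1,
    AddI 9 8 1,
    AddI 10 9 1,
    AddI 13 10 1,
    AddI 11 13 0,
    Const 7 1,
    AddI 6 13 14,
    AddI 12 5 14,
    Add 6 12 10,
    Mul 9 6 6,
    Add 7 7 9,
    AddI 12 12 1,
    AddI 6 6 1,
    JumpLessI 6 11 14,
    AddI 12 13 14,
    AddI 6 13 14,
    Add 8 4 10,
    Mul 9 3 6,
    Add 8 8 9,
    AddI 3 3 1,
    AddI 6 6 1,
    JumpLessI 6 11 23,
    SubI 3 3 0,
    AddI 6 13 14,
    Const 5 0,
    JumpLess 10 12 34,
    JumpLess 8 10 34,
    Add 5 8 10,
    Sub 8 8 5,
    Div 8 8 7,
    Mul 9 8 6,
    Sub 3 3 9,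
    AddI 3 3 1,
    AddI 6 6 1,
    JumpLessI 6 11 36,
    Sub 4 4 8,
    AddI 4 4 1,
    AddI 5 5 1,
    AddI 12 12 1,
    JumpLessI 12 11 21]"

lemma length_ilcp_program [simp]: "length ilcp_program = 46"
  by (simp add: ilcp_program_def)

lemma nth_ilcp_program [simp]:
  "ilcp_program ! 0 = SetI 1 1"
  "ilcp_program ! 1 = AddI 4 4 0"
  "ilcp_program ! Suc 0 = AddI 4 4 0"
  "ilcp_program ! 2 = AddI 2 2 1"
  "ilcp_program ! 3 = JumpLessI 2 0 1"
  "ilcp_program ! 4 = AddI 5 4 0"
  "ilcp_program ! 5 = AddI 7 5 0"
  "ilcp_program ! 6 = AddI 8 7 1"
  "ilcp_program ! 7 = AddI 9 8 1"
  "ilcp_program ! 8 = AddI 10 9 1"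
  "ilcp_program ! 9 = AddI 13 10 1"
  "ilcp_program ! 10 = AddI 11 13 0"
  "ilcp_program ! 11 = Const 7 1"
  "ilcp_program ! 12 = AddI 6 13 14"
  "ilcp_program ! 13 = AddI 12 5 14"
  "ilcp_program ! 14 = Add 6 12 10"
  "ilcp_program ! 15 = Mul 9 6 6"
  "ilcp_program ! 16 = Add 7 7 9"
  "ilcp_program ! 17 = AddI 12 12 1"
  "ilcp_program ! 18 = AddI 6 6 1"
  "ilcp_program ! 19 = JumpLessI 6 11 14"
  "ilcp_program ! 20 = AddI 12 13 14"
  "ilcp_program ! 21 = AddI 6 13 14"
  "ilcp_program ! 22 = Add 8 4 10"
  "ilcp_program ! 23 = Mul 9 3 6"
  "ilcp_program ! 24 = Add 8 8 9"
  "ilcp_program ! 25 = AddI 3 3 1"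
  "ilcp_program ! 26 = AddI 6 6 1"
  "ilcp_program ! 27 = JumpLessI 6 11 23"
  "ilcp_program ! 28 = SubI 3 3 0"
  "ilcp_program ! 29 = AddI 6 13 14"
  "ilcp_program ! 30 = Const 5 0"
  "ilcp_program ! 31 = JumpLess 10 12 34"
  "ilcp_program ! 32 = JumpLess 8 10 34"
  "ilcp_program ! 33 = Add 5 8 10"
  "ilcp_program ! 34 = Sub 8 8 5"
  "ilcp_program ! 35 = Div 8 8 7"
  "ilcp_program ! 36 = Mul 9 8 6"
  "ilcp_program ! 37 = Sub 3 3 9"
  "ilcp_program ! 38 = AddI 3 3 1"
  "ilcp_program ! 39 = AddI 6 6 1"
  "ilcp_program ! 40 = JumpLessI 6 11 36"
  "ilcp_program ! 41 = Sub 4 4 8"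
  "ilcp_program ! 42 = AddI 4 4 1"
  "ilcp_program ! 43 = AddI 5 5 1"
  "ilcp_program ! 44 = AddI 12 12 1"
  "ilcp_program ! 45 = JumpLessI 12 11 21"
  by (simp_all add: ilcp_program_def)

section \<open>Partial runs and their cost\<close>

definition tame :: "nat \<Rightarrow> ('a \<Rightarrow> bool) \<Rightarrow> 'a config \<Rightarrow> bool" where
  "tame I V c \<longleftrightarrow> (\<forall>k. idx c k \<le> I) \<and> (\<forall>a. V (mem c a))"

text \<open>Since \<open>exec\<close> speaks of halting runs only, a partial run from
  \<open>c\<close> to \<open>d\<close> is described by what it adds in front of every halting run
  from \<open>d\<close>. The added cost \<open>t\<close> is the same for all of them.\<close>

definition reaches ::
  "(instr \<Rightarrow> 'a::linordered_field config \<Rightarrow> nat) \<Rightarrow> instr list \<Rightarrow> nat \<Rightarrow> 'a config \<Rightarrow> 'a config \<Rightarrow> bool" where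
  "reaches cost P T c d \<longleftrightarrow> (\<exists>t\<le>T. \<forall>t' e. exec cost P d t' e \<longrightarrow> exec cost P c (t + t') e)"

lemma reaches_refl: "reaches cost P 0 c c"
  by (simp add: reaches_def)

lemma reaches_trans:
  assumes "reaches cost P T c d" and "reaches cost P U d e"
  shows "reaches cost P (T + U) c e"
proof -
  from assms obtain t u where "t \<le> T" "u \<le> U"
    and "\<And>t' f. exec cost P d t' f \<Longrightarrow> exec cost P c (t + t') f"
    and "\<And>t' f. exec cost P e t' f \<Longrightarrow> exec cost P d (u + t') f"
    unfolding reaches_def by blast
  then show ?thesis
    unfolding reaches_def by (intro exI[of _ "t + u"]) (auto simp: add.assoc)
qed

lemma reaches_step:
  assumes "pc c < length P" and "cost (P ! pc c) c \<le> C"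
  shows "reaches cost P C c (step (P ! pc c) c)"
  unfolding reaches_def using assms by (auto intro!: exI[of _ "cost (P ! pc c) c"] exec.step)

text \<open>Keeps the addresses \<open>i * n + j\<close> of row \<open>i\<close> inside the matrix
  block, and bounds the intermediate sums in the computation of \<open>n * n\<close>.\<close>

lemma row_end_le: "i < n \<Longrightarrow> i * n + n \<le> n * n" for n :: nat
  by (metis Suc_leI add.commute mult_Suc mult_le_mono1)

text \<open>The predicate \<open>V\<close> bounds the field elements that occur during the computation, so that \<open>C\<close> bounds the
  cost of a step. It is trivial for unit cost, and a bound on the encoding length for logarithmic cost.\<close>

locale ilcp_run =
  fixes n :: nat and m0 :: "nat \<Rightarrow> 'a::linordered_field" and V :: "'a \<Rightarrow> bool"
    and cost :: "instr \<Rightarrow> 'a config \<Rightarrow> nat" and C :: nat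
    and A :: "nat \<Rightarrow> nat \<Rightarrow> 'a" and q x :: "nat \<Rightarrow> 'a"
  defines "A \<equiv> \<lambda>i j. m0 (i * n + j)" and "q \<equiv> \<lambda>i. m0 (n * n + i)" and "x \<equiv> \<lambda>j. m0 (n * n + n + j)"
  assumes n_pos: "0 < n"
    and m0_outside: "\<And>a. n * n + 2 * n \<le> a \<Longrightarrow> m0 a = 0"
    and cost_le: "\<And>ins c. ins \<in> set ilcp_program \<Longrightarrow> tame (n * n + 3 * n + 4) V c \<Longrightarrow> cost ins c \<le> C"
    and V_m0 [simp]: "\<And>a. V (m0 a)"
    and V_one [simp]: "V 1"
    and V_square [simp]: "\<And>j. V (x j * x j)"
    and V_square_sum [simp]: "\<And>j. j \<le> n \<Longrightarrow> V (1 + (\<Sum>l<j. x l * x l))"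
    and V_prod [simp]: "\<And>i j. V (A i j * x j)"
    and V_partial_residual [simp]: "\<And>i j. j \<le> n \<Longrightarrow> V (q i + (\<Sum>l<j. A i l * x l))"
    and V_residual_diff [simp]: "\<And>i. V (residual n A q x i - slack n A q x i)"
    and V_shift [simp]: "\<And>i. V (shift n A q x i)"
    and V_shift_prod [simp]: "\<And>i j. V (shift n A q x i * x j)"
    and V_A' [simp]: "\<And>i j. V (A i j - shift n A q x i * x j)"
    and V_q' [simp]: "\<And>i. V (q i - shift n A q x i)"
begin

section \<open>Step-counted triples and symbolic execution\<close>

abbreviation "N \<equiv> 1 + (\<Sum>j<n. x j * x j)"
abbreviation "r \<equiv> residual n A q x"
abbreviation "\<sigma> \<equiv> slack n A q x"
abbreviation "\<delta> \<equiv> shift n A q x"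

lemma V_0 [simp]: "V 0"
  using V_m0[of "n * n + 2 * n"] m0_outside[of "n * n + 2 * n"] by simp

lemma V_r [simp]: "V (r i)"
  using V_partial_residual[of n i] by (simp add: residual_def)

text \<open>A Hoare triple for total correctness; \<open>T\<close> counts steps, each charged at the
  uniform bound \<open>C\<close>.\<close>

definition leads :: "nat \<Rightarrow> ('a config \<Rightarrow> bool) \<Rightarrow> ('a config \<Rightarrow> bool) \<Rightarrow> bool" where
  "leads T \<Phi> \<Psi> \<longleftrightarrow> (\<forall>c. \<Phi> c \<longrightarrow> (\<exists>d. reaches cost ilcp_program (T * C) c d \<and> \<Psi> d))"

lemma leads_trans: "leads T \<Phi> \<Psi> \<Longrightarrow> leads U \<Psi> \<Theta> \<Longrightarrow> leads (T + U) \<Phi> \<Theta>"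
  unfolding leads_def by (metis reaches_trans add_mult_distrib)

lemma leads_loop: "(\<And>j. j < k \<Longrightarrow> leads T (\<Phi> j) (\<Phi> (Suc j))) \<Longrightarrow> leads (k * T) (\<Phi> 0) (\<Phi> k)"
proof (induction k)
  case 0
  then show ?case by (auto simp: leads_def intro: reaches_refl)
next
  case (Suc k)
  then have "leads (k * T + T) (\<Phi> 0) (\<Phi> (Suc k))" by (intro leads_trans[of _ _ "\<Phi> k"]) auto
  then show ?case by (simp add: add.commute)
qed

text \<open>Together with \<open>valued\<close> this is \<open>tame\<close>, split so that an update
  of a register or of a cell affects only one half.\<close>

definition small :: "(nat \<Rightarrow> nat) \<Rightarrow> bool" where
  "small f \<longleftrightarrow> (\<forall>k. f k \<le> n * n + 3 * n + 4)"

definition valued :: "(nat \<Rightarrow> 'a) \<Rightarrow> bool" where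
  "valued m \<longleftrightarrow> (\<forall>a. V (m a))"

lemma small_upd [simp]: "small f \<Longrightarrow> v \<le> n * n + 3 * n + 4 \<Longrightarrow> small (f(k := v))"
  by (simp add: small_def)

lemma valued_upd [simp]: "valued m \<Longrightarrow> V v \<Longrightarrow> valued (m(a := v))"
  by (simp add: valued_def)

definition goes :: "nat \<Rightarrow> 'a config \<Rightarrow> 'a config \<Rightarrow> bool" where
  "goes T c d \<longleftrightarrow> reaches cost ilcp_program (T * C) c d"

lemma goes_refl: "goes 0 c c"
  by (simp add: goes_def reaches_refl)

text \<open>Symbolic execution of one instruction on an explicit configuration. \<open>T\<close> is
  the number of steps left; a stretch of code ends with \<open>goes_refl\<close> when it reaches
  0.\<close>

lemma goes_step:
  assumes "p < 46" and "small f" and "valued m" and "0 < T"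
    and "goes (T - 1) (step (ilcp_program ! p) \<lparr>pc = p, idx = f, mem = m\<rparr>) d"
  shows "goes T \<lparr>pc = p, idx = f, mem = m\<rparr> d"
proof -
  let ?c = "\<lparr>pc = p, idx = f, mem = m\<rparr>"
  have "reaches cost ilcp_program C ?c (step (ilcp_program ! pc ?c) ?c)"
    using assms by (intro reaches_step cost_le) (auto simp: small_def valued_def tame_def)
  then have "reaches cost ilcp_program (C + (T - 1) * C) ?c d"
    using assms(5) unfolding goes_def by (intro reaches_trans) auto
  also have "C + (T - 1) * C = T * C"
    using \<open>0 < T\<close> by (cases T) auto
  finally show ?thesis by (simp add: goes_def)
qed

lemma goes_mono: "goes T c d \<Longrightarrow> T \<le> U \<Longrightarrow> goes U c d"
  unfolding goes_def reaches_def by (meson le_trans mult_le_mono1)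

lemma leadsI: "(\<And>p f m. \<Phi> \<lparr>pc = p, idx = f, mem = m\<rparr> \<Longrightarrow> \<exists>d. goes T \<lparr>pc = p, idx = f, mem = m\<rparr> d \<and> \<Psi> d) \<Longrightarrow> leads T \<Phi> \<Psi>"
  unfolding leads_def goes_def by (metis config.cases)

text \<open>Indices cannot be multiplied, so \<open>n * n\<close> is a repeated sum. As in the later
  loop invariants, the program counter is at the start of the body while passes remain, and at the
  exit afterwards.\<close>

definition squaring :: "nat \<Rightarrow> 'a config \<Rightarrow> bool" where
  "squaring k c \<longleftrightarrow> pc c = (if k < n then 1 else 4) \<and> idx c = (\<lambda>_. 0)(0 := n, 1 := 1, 2 := k, 4 := k * n) \<and> mem c = m0"

lemma valued_m0 [simp]: "valued m0"
  by (simp add: valued_def)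

lemma squaring_start: "leads 1 (\<lambda>c. c = \<lparr>pc = 0, idx = (\<lambda>_. 0)(0 := n), mem = m0\<rparr>) (squaring 0)"
proof (rule leadsI)
  fix p f m assume "\<lparr>pc = p, idx = f, mem = m\<rparr> = \<lparr>pc = 0, idx = (\<lambda>_. 0)(0 := n), mem = m0\<rparr>"
  then have [simp]: "p = 0" "m = m0" and f: "f = (\<lambda>_. 0)(0 := n)" by auto
  have [simp]: "small f" by (simp add: small_def f)
  show "\<exists>d. goes 1 \<lparr>pc = p, idx = f, mem = m\<rparr> d \<and> squaring 0 d"
    apply (rule exI, rule conjI)
    apply simp
    apply (rule goes_step, simp, simp, simp, simp, simp)
    apply (rule goes_refl)
    using n_pos apply (auto simp: squaring_def f)
    done
qed

lemma squaring_step: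
  assumes "k < n"
  shows "leads 3 (squaring k) (squaring (Suc k))"
proof (rule leadsI)
  fix p f m assume c: "squaring k \<lparr>pc = p, idx = f, mem = m\<rparr>"
  have kn: "k * n + n \<le> n * n" using assms by (rule row_end_le)
  have f: "f = (\<lambda>_. 0)(0 := n, 1 := 1, 2 := k, 4 := k * n)" and [simp]: "p = Suc 0" "m = m0"
    using c assms by (auto simp: squaring_def)
  have [simp]: "small f" "f 0 = n" "f (Suc 0) = Suc 0" "f 2 = k" "f 4 = k * n"
    unfolding f using assms kn by (auto simp: small_def)
  show "\<exists>d. goes 3 \<lparr>pc = p, idx = f, mem = m\<rparr> d \<and> squaring (Suc k) d"
    apply (rule exI, rule conjI)
    using kn assms apply simp
    apply (rule goes_step, simp, simp, simp, simp, simp flip: numeral_2_eq_2 split del: if_split)+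
    apply (rule goes_refl)
    using assms apply (auto simp: squaring_def f)
    done
qed

section \<open>Invariants for registers and memory\<close>

definition b :: nat where
  "b = n * n + 2 * n"

text \<open>An equation in the form of two inequalities: linear arithmetic can separate addresses
  while \<open>b\<close> itself is not rewritten.\<close>

lemma b_bounds: "n * n + 2 * n \<le> b" "b \<le> n * n + 2 * n"
  by (simp_all add: b_def)

text \<open>These registers are never written again once the addresses are set up.\<close>

definition frame :: "(nat \<Rightarrow> nat) \<Rightarrow> bool" where
  "frame f \<longleftrightarrow> f 0 = n \<and> f 1 = 1 \<and> f 7 = b \<and> f 8 = b + 1 \<and> f 9 = b + 2 \<and> f 10 = b + 3 \<and>
     f 11 = b + 4 + n \<and> f 13 = b + 4 \<and> f 14 = 0 \<and> small f"

lemma frameD: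
  assumes "frame f"
  shows "f 0 = n" "f (Suc 0) = Suc 0" "f 7 = b" "f 8 = Suc b" "f 9 = Suc (Suc b)" "f 10 = b + 3"
    "f 11 = b + 4 + n" "f 13 = b + 4" "f 14 = 0" "small f"
  using assms by (simp_all add: frame_def)

lemma frame_upd [simp]:
  "frame f \<Longrightarrow> k \<notin> {0, 1, 7, 8, 9, 10, 11, 13, 14} \<Longrightarrow> v \<le> n * n + 3 * n + 4 \<Longrightarrow> frame (f(k := v))"
  by (simp add: frame_def)

text \<open>Cell \<open>b + 3\<close> must remain 0 because there is no move instruction: a cell is
  copied by adding this one, and sign tests compare with it.\<close>

definition copied :: "nat \<Rightarrow> (nat \<Rightarrow> 'a) \<Rightarrow> bool" where
  "copied j m \<longleftrightarrow> valued m \<and> (\<forall>a<b. m a = m0 a) \<and> (\<forall>k<j. m (b + 4 + k) = x k) \<and>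
     m b = 1 + (\<Sum>k<j. x k * x k) \<and> m (b + 3) = 0"

lemma copied_0: "copied 0 (m0(b := 1))"
  using m0_outside[of "b + 3"] b_bounds by (auto simp: copied_def)

lemma copied_Suc:
  assumes "copied j m" and "j < n"
  shows "copied (Suc j) (m(b + 4 + j := x j, Suc (Suc b) := x j * x j,
    b := 1 + (\<Sum>k<j. x k * x k) + x j * x j))"
proof -
  have "V (x j)" by (simp add: x_def)
  moreover have "V (1 + (\<Sum>k<j. x k * x k) + x j * x j)"
    using V_square_sum[of "Suc j"] assms(2) by (simp add: add.assoc)
  ultimately show ?thesis
    using assms by (simp add: copied_def All_less_Suc add.assoc)
qed

text \<open>Indexed by the linear address, so that the entries corrected so far are an initial
  segment of the memory, described by a single bound.\<close>

definition M' :: "nat \<Rightarrow> 'a" where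
  "M' a = m0 a - \<delta> (a div n) * x (a mod n)"

lemma M'_entry: "j < n \<Longrightarrow> M' (i * n + j) = A i j - \<delta> i * x j"
  by (simp add: M'_def A_def)

text \<open>The input is overwritten in place: \<open>p\<close>, \<open>k\<close> and
  \<open>l\<close> count the finished entries of the matrix, of the vector \<open>q\<close> and of
  the slacks. Within a row \<open>l\<close> runs ahead of \<open>k\<close>, and the copy at
  \<open>b + 4\<close> supplies the lost entries of \<open>x\<close>.\<close>

definition layout :: "nat \<Rightarrow> nat \<Rightarrow> nat \<Rightarrow> (nat \<Rightarrow> 'a) \<Rightarrow> bool" where
  "layout p k l m \<longleftrightarrow> valued m \<and> (\<forall>a<n * n. m a = (if a < p then M' a else m0 a)) \<and>
     (\<forall>i<n. m (n * n + i) = (if i < k then q i - \<delta> i else q i)) \<and>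
     (\<forall>i<n. m (n * n + n + i) = (if i < l then \<sigma> i else x i)) \<and>
     (\<forall>j<n. m (b + 4 + j) = x j) \<and> m b = N \<and> m (b + 3) = 0"

lemma layoutD:
  assumes "layout p k l m"
  shows "valued m" "m b = N" "m (b + 3) = 0" "j < n \<Longrightarrow> m (b + 4 + j) = x j"
    "k < n \<Longrightarrow> m (n * n + k) = q k"
  using assms by (simp_all add: layout_def)

lemma layout_copied:
  assumes "copied n m"
  shows "layout 0 0 0 m"
proof -
  have "m (n * n + i) = q i" "m (n * n + n + i) = x i" if "i < n" for i
    using that assms b_bounds by (simp_all add: copied_def q_def x_def)
  then show ?thesis
    using assms b_bounds by (simp add: copied_def layout_def)
qed

lemma layout_scratch [simp]:
  assumes "layout p k l m" and "V v"
  shows "layout p k l (m(Suc b := v))" and "layout p k l (m(Suc (Suc b) := v))"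
  using assms b_bounds by (simp_all add: layout_def)

lemma layout_matrix:
  assumes "layout (i * n + j) k l m" and "i < n" "j < n"
  shows "layout (Suc (i * n + j)) k l (m(i * n + j := A i j - \<delta> i * x j))"
  using assms b_bounds row_end_le[OF assms(2)] M'_entry[OF assms(3), of i]
  by (simp add: layout_def less_Suc_eq)

lemma layout_vector:
  assumes "layout p k l m" and "k < n"
  shows "layout p (Suc k) l (m(n * n + k := q k - \<delta> k))"
  using assms b_bounds by (simp add: layout_def less_Suc_eq)

lemma V_slack [simp]: "V (\<sigma> i)"
  by (simp add: slack_def)

lemma layout_slack:
  assumes "layout p k l m" and "l < n"
  shows "layout p k (Suc l) (m(n * n + n + l := \<sigma> l))"
  using assms b_bounds by (simp add: layout_def less_Suc_eq)

definition copying :: "nat \<Rightarrow> 'a config \<Rightarrow> bool" where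
  "copying j c \<longleftrightarrow> pc c = (if j < n then 14 else 20) \<and> frame (idx c) \<and>
     idx c 3 = 0 \<and> idx c 4 = n * n \<and> idx c 5 = n * n + n \<and> idx c 6 = b + 4 + j \<and>
     idx c 12 = n * n + n + j \<and> copied j (mem c)"

definition row_pointers :: "nat \<Rightarrow> (nat \<Rightarrow> nat) \<Rightarrow> bool" where
  "row_pointers i f \<longleftrightarrow> f 4 = n * n + i \<and> f 5 = n * n + n + i \<and> f 12 = b + 4 + i"

lemma row_pointersD:
  assumes "row_pointers i f"
  shows "f 4 = n * n + i" "f 5 = n * n + n + i" "f 12 = b + 4 + i"
  using assms by (simp_all add: row_pointers_def)

lemma row_pointers_upd [simp]:
  "row_pointers i f \<Longrightarrow> k \<notin> {4, 5, 12} \<Longrightarrow> row_pointers i (f(k := v))"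
  by (simp add: row_pointers_def)

definition row :: "nat \<Rightarrow> 'a config \<Rightarrow> bool" where
  "row i c \<longleftrightarrow> pc c = (if i < n then 21 else 46) \<and> frame (idx c) \<and> row_pointers i (idx c) \<and>
     idx c 3 = i * n \<and> layout (i * n) i i (mem c)"

definition dotting :: "nat \<Rightarrow> nat \<Rightarrow> 'a config \<Rightarrow> bool" where
  "dotting i j c \<longleftrightarrow> pc c = (if j < n then 23 else 28) \<and> frame (idx c) \<and> row_pointers i (idx c) \<and>
     idx c 3 = i * n + j \<and> idx c 6 = b + 4 + j \<and> layout (i * n) i i (mem c) \<and>
     mem c (Suc b) = q i + (\<Sum>l<j. A i l * x l)"

text \<open>The point where the three branches of the slack computation meet.\<close>

definition projecting :: "nat \<Rightarrow> 'a config \<Rightarrow> bool" where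
  "projecting i c \<longleftrightarrow> pc c = 34 \<and> frame (idx c) \<and> row_pointers i (idx c) \<and>
     idx c 3 = i * n \<and> idx c 6 = b + 4 \<and> layout (i * n) i (Suc i) (mem c) \<and> mem c (Suc b) = r i"

definition updating :: "nat \<Rightarrow> nat \<Rightarrow> 'a config \<Rightarrow> bool" where
  "updating i j c \<longleftrightarrow> pc c = (if j < n then 36 else 41) \<and> frame (idx c) \<and> row_pointers i (idx c) \<and>
     idx c 3 = i * n + j \<and> idx c 6 = b + 4 + j \<and> layout (i * n + j) i (Suc i) (mem c) \<and>
     mem c (Suc b) = \<delta> i"

section \<open>Passes through the program\<close>

lemma copying_start: "leads 10 (squaring n) (copying 0)"
proof (rule leadsI)
  fix p f m assume c: "squaring n \<lparr>pc = p, idx = f, mem = m\<rparr>"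
  have f: "f = (\<lambda>_. 0)(0 := n, 1 := 1, 2 := n, 4 := n * n)" and [simp]: "p = 4" "m = m0"
    using c by (auto simp: squaring_def)
  have [simp]: "small f" "f 0 = n" "f (Suc 0) = Suc 0" "f 3 = 0" "f 4 = n * n" "f 14 = 0"
    unfolding f by (auto simp: small_def)
  have [simp]: "n * n + n + n = b" by (simp add: b_def)
  show "\<exists>d. goes 10 \<lparr>pc = p, idx = f, mem = m\<rparr> d \<and> copying 0 d"
    apply (rule exI, rule conjI)
    using b_bounds n_pos apply simp
    apply (rule goes_step, simp, simp, simp, simp, simp)+
    apply (rule goes_refl)
    using b_bounds n_pos apply (simp add: copying_def frame_def copied_0)
    done
qed

lemma copying_step:
  assumes "j < n"
  shows "leads 6 (copying j) (copying (Suc j))"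
proof (rule leadsI)
  fix p f m assume c: "copying j \<lparr>pc = p, idx = f, mem = m\<rparr>"
  have [simp]: "p = 14" "f 3 = 0" "f 4 = n * n" "f 5 = n * n + n" "f 6 = b + 4 + j" "f 12 = n * n + n + j"
    and [simp]: "frame f" and copied: "copied j m"
    using c assms by (auto simp: copying_def)
  note [simp] = frameD[OF \<open>frame f\<close>]
  have [simp]: "m (n * n + n + j) = x j" "V (x j)" "m b = 1 + (\<Sum>k<j. x k * x k)" "m (b + 3) = 0" "valued m"
    using copied b_bounds assms by (auto simp: x_def copied_def)
  have [simp]: "V (1 + (\<Sum>k<j. x k * x k) + x j * x j)"
    using V_square_sum[of "Suc j"] assms by (simp add: add.assoc)
  show "\<exists>d. goes 6 \<lparr>pc = p, idx = f, mem = m\<rparr> d \<and> copying (Suc j) d"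
    apply (rule exI, rule conjI)
    using b_bounds assms apply simp
    apply (rule goes_step, simp, simp, simp, simp, simp split del: if_split)+
    apply (rule goes_refl)
    using b_bounds assms copied_Suc[OF copied assms] apply (simp add: copying_def)
    done
qed

lemma row_start: "leads 1 (copying n) (row 0)"
proof (rule leadsI)
  fix p f m assume c: "copying n \<lparr>pc = p, idx = f, mem = m\<rparr>"
  have [simp]: "p = 20" "f 3 = 0" "f 4 = n * n" "f 5 = n * n + n"
    and [simp]: "frame f" and copied: "copied n m"
    using c by (auto simp: copying_def)
  note [simp] = frameD[OF \<open>frame f\<close>]
  have [simp]: "valued m" using copied by (simp add: copied_def)
  show "\<exists>d. goes 1 \<lparr>pc = p, idx = f, mem = m\<rparr> d \<and> row 0 d"
    apply (rule exI, rule conjI)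
    using b_bounds apply simp
    apply (rule goes_step, simp, simp, simp, simp, simp split del: if_split)
    apply (rule goes_refl)
    using b_bounds n_pos layout_copied[OF copied] apply (simp add: row_def row_pointers_def)
    done
qed

lemma dotting_start:
  assumes "i < n"
  shows "leads 2 (row i) (dotting i 0)"
proof (rule leadsI)
  fix p f m assume c: "row i \<lparr>pc = p, idx = f, mem = m\<rparr>"
  have [simp]: "p = 21" "f 3 = i * n" "frame f" "row_pointers i f" "layout (i * n) i i m"
    using c assms by (auto simp: row_def)
  note [simp] = frameD[OF \<open>frame f\<close>] row_pointersD[OF \<open>row_pointers i f\<close>] layoutD[OF \<open>layout (i * n) i i m\<close>]
  have [simp]: "V (q i)" by (simp add: q_def)
  show "\<exists>d. goes 2 \<lparr>pc = p, idx = f, mem = m\<rparr> d \<and> dotting i 0 d"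
    apply (rule exI, rule conjI)
    using b_bounds assms apply simp
    apply (rule goes_step, simp, simp, simp, simp, simp split del: if_split)+
    apply (rule goes_refl)
    using b_bounds assms n_pos apply (simp add: dotting_def)
    done
qed

lemma dotting_step:
  assumes "i < n" "j < n"
  shows "leads 5 (dotting i j) (dotting i (Suc j))"
proof (rule leadsI)
  fix p f m assume c: "dotting i j \<lparr>pc = p, idx = f, mem = m\<rparr>"
  have [simp]: "p = 23" "f 3 = i * n + j" "f 6 = b + 4 + j" "frame f" "row_pointers i f"
      "layout (i * n) i i m" "m (Suc b) = q i + (\<Sum>l<j. A i l * x l)"
    using c assms by (auto simp: dotting_def)
  note [simp] = frameD[OF \<open>frame f\<close>] row_pointersD[OF \<open>row_pointers i f\<close>] layoutD[OF \<open>layout (i * n) i i m\<close>]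
  have ij: "i * n + n \<le> n * n" using assms(1) by (rule row_end_le)
  have [simp]: "m (i * n + j) = A i j"
    using \<open>layout (i * n) i i m\<close> assms ij by (simp add: layout_def A_def)
  have [simp]: "V (q i + ((\<Sum>l<j. A i l * x l) + A i j * x j))"
    using V_partial_residual[of "Suc j" i] assms by simp
  then have [simp]: "V (q i + (\<Sum>l<j. A i l * x l) + A i j * x j)"
    by (simp only: add.assoc)
  show "\<exists>d. goes 5 \<lparr>pc = p, idx = f, mem = m\<rparr> d \<and> dotting i (Suc j) d"
    apply (rule exI, rule conjI)
    using b_bounds assms ij apply simp
    apply (rule goes_step, simp, simp, simp, simp, simp split del: if_split)+
    apply (rule goes_refl)
    using b_bounds assms ij apply (simp add: dotting_def add.assoc[of "q i"])
    done
qed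

text \<open>The slack is first set to 0, and either successful sign test jumps over its replacement
  by the residual. The sign of \<open>x i\<close> is read from the copy, as the original cell has
  just been overwritten. The three paths take 4, 5 and 6 steps; \<open>goes_mono\<close> levels
  them.\<close>

lemma projecting_start:
  assumes "i < n"
  shows "leads 6 (dotting i n) (projecting i)"
proof (rule leadsI)
  fix p f m assume c: "dotting i n \<lparr>pc = p, idx = f, mem = m\<rparr>"
  have [simp]: "p = 28" "f 3 = i * n + n" "frame f" "row_pointers i f" "layout (i * n) i i m" "m (Suc b) = r i"
    using c by (auto simp: dotting_def residual_def)
  note [simp] = frameD[OF \<open>frame f\<close>] row_pointersD[OF \<open>row_pointers i f\<close>] layoutD[OF \<open>layout (i * n) i i m\<close>]
  have ij: "i * n + n \<le> n * n" using assms(1) by (rule row_end_le)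
  note out = layout_slack[OF \<open>layout (i * n) i i m\<close> assms]
  consider "0 < x i" | "\<not> 0 < x i" "r i < 0" | "\<not> 0 < x i" "\<not> r i < 0" by blast
  then show "\<exists>d. goes 6 \<lparr>pc = p, idx = f, mem = m\<rparr> d \<and> projecting i d"
  proof cases
    case 1
    then have [simp]: "\<sigma> i = 0" by (simp add: slack_def)
    show ?thesis
      apply (rule exI, rule conjI)
       apply (rule goes_mono[of 4])
      using b_bounds assms ij 1 apply simp
        apply (rule goes_step, simp, simp, simp, simp, simp split del: if_split)+
        apply (rule goes_refl)
       apply simp
      using b_bounds assms ij out apply (simp add: projecting_def)
      done
  next
    case 2
    then have [simp]: "\<sigma> i = 0" by (simp add: slack_def)
    show ?thesis
      apply (rule exI, rule conjI)
       apply (rule goes_mono[of 5])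
      using b_bounds assms ij 2 apply simp
        apply (rule goes_step, simp, simp, simp, simp, simp split del: if_split)+
        apply (rule goes_refl)
       apply simp
      using b_bounds assms ij out apply (simp add: projecting_def)
      done
  next
    case 3
    then have [simp]: "\<sigma> i = r i" by (simp add: slack_def)
    show ?thesis
      apply (rule exI, rule conjI)
      using b_bounds assms ij 3 apply simp
       apply (rule goes_step, simp, simp, simp, simp, simp split del: if_split)+
       apply (rule goes_refl)
      using b_bounds assms ij out apply (simp add: projecting_def)
      done
  qed
qed

lemma updating_start:
  assumes "i < n"
  shows "leads 2 (projecting i) (updating i 0)"
proof (rule leadsI)
  fix p f m assume c: "projecting i \<lparr>pc = p, idx = f, mem = m\<rparr>"
  have [simp]: "p = 34" "f 3 = i * n" "f 6 = b + 4" "frame f" "row_pointers i f"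
      "layout (i * n) i (Suc i) m" "m (Suc b) = r i"
    using c by (auto simp: projecting_def)
  note [simp] = frameD[OF \<open>frame f\<close>] row_pointersD[OF \<open>row_pointers i f\<close>] layoutD[OF \<open>layout (i * n) i (Suc i) m\<close>]
  have [simp]: "m (n * n + n + i) = \<sigma> i"
    using \<open>layout (i * n) i (Suc i) m\<close> assms by (simp add: layout_def)
  have [simp]: "(r i - \<sigma> i) / N = \<delta> i" by (simp add: shift_def)
  show "\<exists>d. goes 2 \<lparr>pc = p, idx = f, mem = m\<rparr> d \<and> updating i 0 d"
    apply (rule exI, rule conjI)
    using b_bounds assms apply simp
    apply (rule goes_step, simp, simp, simp, simp, simp split del: if_split)+
    apply (rule goes_refl)
    using b_bounds assms n_pos apply (simp add: updating_def)
    done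
qed

lemma updating_step:
  assumes "i < n" "j < n"
  shows "leads 5 (updating i j) (updating i (Suc j))"
proof (rule leadsI)
  fix p f m assume c: "updating i j \<lparr>pc = p, idx = f, mem = m\<rparr>"
  have [simp]: "p = 36" "f 3 = i * n + j" "f 6 = b + 4 + j" "frame f" "row_pointers i f"
      "layout (i * n + j) i (Suc i) m" "m (Suc b) = \<delta> i"
    using c assms by (auto simp: updating_def)
  note [simp] = frameD[OF \<open>frame f\<close>] row_pointersD[OF \<open>row_pointers i f\<close>] layoutD[OF \<open>layout (i * n + j) i (Suc i) m\<close>]
  have ij: "i * n + n \<le> n * n" using assms(1) by (rule row_end_le)
  have [simp]: "m (i * n + j) = A i j"
    using \<open>layout (i * n + j) i (Suc i) m\<close> assms ij by (simp add: layout_def A_def)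
  have [simp]: "layout (Suc (i * n + j)) i (Suc i) (m(Suc (Suc b) := \<delta> i * x j, i * n + j := A i j - \<delta> i * x j))"
    by (intro layout_matrix layout_scratch) (use assms in simp_all)
  show "\<exists>d. goes 5 \<lparr>pc = p, idx = f, mem = m\<rparr> d \<and> updating i (Suc j) d"
    apply (rule exI, rule conjI)
    using b_bounds assms ij apply simp
    apply (rule goes_step, simp, simp, simp, simp, simp split del: if_split)+
    apply (rule goes_refl)
    using b_bounds assms ij apply (simp add: updating_def)
    done
qed

text \<open>The matrix pointer has already arrived at \<open>Suc i * n\<close>, the start of the
  next row, so only the other three pointers are advanced.\<close>

lemma row_step:
  assumes "i < n"
  shows "leads 5 (updating i n) (row (Suc i))"
proof (rule leadsI)
  fix p f m assume c: "updating i n \<lparr>pc = p, idx = f, mem = m\<rparr>"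
  have [simp]: "p = 41" "f 3 = i * n + n" "frame f" "row_pointers i f"
      "layout (i * n + n) i (Suc i) m" "m (Suc b) = \<delta> i"
    using c by (auto simp: updating_def)
  note [simp] = frameD[OF \<open>frame f\<close>] row_pointersD[OF \<open>row_pointers i f\<close>] layoutD[OF \<open>layout (i * n + n) i (Suc i) m\<close>]
  have ij: "i * n + n \<le> n * n" using assms(1) by (rule row_end_le)
  show "\<exists>d. goes 5 \<lparr>pc = p, idx = f, mem = m\<rparr> d \<and> row (Suc i) d"
    apply (rule exI, rule conjI)
    using b_bounds assms ij apply simp
    apply (rule goes_step, simp, simp, simp, simp, simp split del: if_split)+
    apply (rule goes_refl)
    using b_bounds assms ij layout_vector[OF \<open>layout (i * n + n) i (Suc i) m\<close> assms]
    apply (simp add: row_def row_pointers_def add.commute[of n])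
    done
qed

text \<open>The terms \<open>3 * n\<close> and \<open>6 * n\<close> come from squaring and copying,
  and 12 from the code before and between these loops and the rows. A row consists of two column
  loops with 5 steps per column and 15 steps around them.\<close>

lemma ilcp_program_leads:
  "leads (3 * n + 6 * n + n * (5 * n + 5 * n + 15) + 12)
     (\<lambda>c. c = \<lparr>pc = 0, idx = (\<lambda>_. 0)(0 := n), mem = m0\<rparr>) (row n)"
proof -
  have row: "leads (5 * n + 5 * n + 15) (row i) (row (Suc i))" if i: "i < n" for i
  proof -
    have "leads (n * 5) (dotting i 0) (dotting i n)"
      by (rule leads_loop) (use dotting_step i in blast)
    moreover have "leads (n * 5) (updating i 0) (updating i n)"
      by (rule leads_loop) (use updating_step i in blast)
    ultimately have "leads (2 + n * 5 + 6 + 2 + n * 5 + 5) (row i) (row (Suc i))"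
      using leads_trans dotting_start[OF i] projecting_start[OF i] updating_start[OF i] row_step[OF i]
      by meson
    then show ?thesis by (simp add: algebra_simps)
  qed
  have "leads (n * 3) (squaring 0) (squaring n)" "leads (n * 6) (copying 0) (copying n)"
    "leads (n * (5 * n + 5 * n + 15)) (row 0) (row n)"
    by (intro leads_loop squaring_step copying_step row; assumption)+
  then have "leads (1 + n * 3 + 10 + n * 6 + 1 + n * (5 * n + 5 * n + 15))
      (\<lambda>c. c = \<lparr>pc = 0, idx = (\<lambda>_. 0)(0 := n), mem = m0\<rparr>) (row n)"
    using leads_trans squaring_start copying_start row_start by meson
  then show ?thesis by (simp add: algebra_simps)
qed

lemma ilcp_program_exec:
  obtains t c where
    "exec cost ilcp_program \<lparr>pc = 0, idx = (\<lambda>_. 0)(0 := n), mem = m0\<rparr> t c"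
    "t \<le> (3 * n + 6 * n + n * (5 * n + 5 * n + 15) + 12) * C"
    "\<And>i j. i < n \<Longrightarrow> j < n \<Longrightarrow> mem c (i * n + j) = A i j - \<delta> i * x j"
    "\<And>i. i < n \<Longrightarrow> mem c (n * n + i) = q i - \<delta> i"
    "\<And>i. i < n \<Longrightarrow> mem c (n * n + n + i) = \<sigma> i"
proof -
  obtain c where c: "row n c" and reach: "reaches cost ilcp_program
      ((3 * n + 6 * n + n * (5 * n + 5 * n + 15) + 12) * C) \<lparr>pc = 0, idx = (\<lambda>_. 0)(0 := n), mem = m0\<rparr> c"
    using ilcp_program_leads unfolding leads_def by blast
  \<comment> \<open>In \<open>row n\<close> the program counter is past the last instruction, so the
    empty run from \<open>c\<close> completes the partial run.\<close>
  have "exec cost ilcp_program c 0 c"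
    using c by (intro exec.halt) (simp add: row_def)
  then obtain t where "exec cost ilcp_program \<lparr>pc = 0, idx = (\<lambda>_. 0)(0 := n), mem = m0\<rparr> t c"
    and "t \<le> (3 * n + 6 * n + n * (5 * n + 5 * n + 15) + 12) * C"
    using reach unfolding reaches_def by (metis add.right_neutral)
  moreover have "mem c (i * n + j) = A i j - \<delta> i * x j" if "i < n" "j < n" for i j
  proof -
    have "i * n + j < n * n" using row_end_le[OF that(1)] that(2) by linarith
    then show ?thesis using c M'_entry[OF that(2)] by (simp add: row_def layout_def)
  qed
  moreover have "mem c (n * n + i) = q i - \<delta> i" "mem c (n * n + n + i) = \<sigma> i" if "i < n" for i
    using c that by (simp_all add: row_def layout_def)
  ultimately show ?thesis by (rule that)
qed

end

section \<open>Encoding lengths of rational numbers\<close>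

text \<open>Fractions need not be in lowest terms here, so that no cancellation has to be considered in the
  bounds for the field operations.\<close>

definition frac_bits :: "nat \<Rightarrow> rat \<Rightarrow> bool" where
  "frac_bits k r \<longleftrightarrow> (\<exists>a b. 0 < b \<and> r = of_int a / of_int b \<and> \<bar>a\<bar> < 2 ^ k \<and> b < 2 ^ k)"

lemma frac_bits_mono:
  assumes "frac_bits k r" and "k \<le> l"
  shows "frac_bits l r"
proof -
  obtain a b where "0 < b" "r = of_int a / of_int b" "\<bar>a\<bar> < 2 ^ k" "b < 2 ^ k"
    using assms(1) unfolding frac_bits_def by auto
  moreover have "(2::int) ^ k \<le> 2 ^ l" using assms(2) by simp
  ultimately have "0 < b" "r = of_int a / of_int b" "\<bar>a\<bar> < 2 ^ l" "b < 2 ^ l"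
    by linarith+
  then show ?thesis unfolding frac_bits_def by blast
qed

lemma frac_bits_0 [simp]: "0 < k \<Longrightarrow> frac_bits k 0"
  unfolding frac_bits_def by (rule exI[of _ 0], rule exI[of _ 1]) simp

lemma frac_bits_1 [simp]: "0 < k \<Longrightarrow> frac_bits k 1"
  unfolding frac_bits_def by (rule exI[of _ 1], rule exI[of _ 1]) simp

lemma frac_bits_uminus: "frac_bits k r \<Longrightarrow> frac_bits k (- r)"
  unfolding frac_bits_def by (metis abs_minus_cancel minus_divide_left of_int_minus)

text \<open>The numerator over the common denominator is a sum of two cross products, each bounded
  by \<open>2 ^ (k + l)\<close>; this sum costs the extra bit.\<close>

lemma frac_bits_add:
  assumes "frac_bits k r" and "frac_bits l s"
  shows "frac_bits (k + l + 1) (r + s)"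
proof -
  obtain a b c d where ab: "0 < b" "r = of_int a / of_int b" "\<bar>a\<bar> < 2 ^ k" "b < 2 ^ k"
    and cd: "0 < d" "s = of_int c / of_int d" "\<bar>c\<bar> < 2 ^ l" "d < 2 ^ l"
    using assms unfolding frac_bits_def by auto
  have "\<bar>a\<bar> * d \<le> 2 ^ k * 2 ^ l" "\<bar>c\<bar> * b < 2 ^ l * 2 ^ k" "b * d < 2 ^ k * 2 ^ l"
    using ab cd by (auto intro!: mult_mono mult_strict_mono')
  moreover have "\<bar>a * d + c * b\<bar> \<le> \<bar>a\<bar> * d + \<bar>c\<bar> * b"
    using ab cd by (simp add: abs_mult abs_triangle_ineq[THEN order_trans])
  ultimately have "\<bar>a * d + c * b\<bar> < 2 ^ (k + l + 1)" "b * d < 2 ^ (k + l + 1)"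
    by (auto simp: power_add algebra_simps)
  moreover have "r + s = of_int (a * d + c * b) / of_int (b * d)"
    using ab cd by (simp add: field_simps)
  moreover have "0 < b * d" using ab cd by simp
  ultimately show ?thesis unfolding frac_bits_def by blast
qed

lemma frac_bits_diff:
  "frac_bits k r \<Longrightarrow> frac_bits l s \<Longrightarrow> frac_bits (k + l + 1) (r - s)"
  using frac_bits_add[OF _ frac_bits_uminus] by simp

lemma frac_bits_mult:
  assumes "frac_bits k r" and "frac_bits l s"
  shows "frac_bits (k + l) (r * s)"
proof -
  obtain a b c d where ab: "0 < b" "r = of_int a / of_int b" "\<bar>a\<bar> < 2 ^ k" "b < 2 ^ k"
    and cd: "0 < d" "s = of_int c / of_int d" "\<bar>c\<bar> < 2 ^ l" "d < 2 ^ l"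
    using assms unfolding frac_bits_def by auto
  have "\<bar>a * c\<bar> < 2 ^ (k + l)" "b * d < 2 ^ (k + l)"
    using ab cd by (auto simp: power_add abs_mult intro!: mult_strict_mono')
  moreover have "r * s = of_int (a * c) / of_int (b * d)" "0 < b * d"
    using ab cd by simp_all
  ultimately show ?thesis unfolding frac_bits_def by blast
qed

text \<open>Numerator and denominator change places, with both signs flipped when
  \<open>a < 0\<close> to keep the denominator positive. For \<open>r = 0\<close> the convention
  \<open>inverse 0 = 0\<close> applies, and \<open>0 < k\<close> leaves room for the denominator
  1.\<close>

lemma frac_bits_inverse:
  assumes "frac_bits k r" and "0 < k"
  shows "frac_bits k (inverse r)"
proof -
  obtain a b where ab: "0 < b" "r = of_int a / of_int b" "\<bar>a\<bar> < 2 ^ k" "b < 2 ^ k"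
    using assms(1) unfolding frac_bits_def by auto
  consider "a = 0" | "a > 0" | "a < 0" by linarith
  then show ?thesis
  proof cases
    case 1
    then show ?thesis using ab assms(2) by simp
  next
    case 2
    then show ?thesis unfolding frac_bits_def
      using ab by (intro exI[of _ b] exI[of _ a]) simp
  next
    case 3
    then show ?thesis unfolding frac_bits_def
      using ab by (intro exI[of _ "- b"] exI[of _ "- a"]) simp
  qed
qed

lemma frac_bits_divide:
  "frac_bits k r \<Longrightarrow> frac_bits l s \<Longrightarrow> 0 < l \<Longrightarrow> frac_bits (k + l) (r / s)"
  using frac_bits_mult[OF _ frac_bits_inverse] by (simp add: divide_inverse)

text \<open>Denominators multiply, but their lengths only add: growth is linear in the number of
  summands. The final 1 accommodates the empty sum.\<close>

lemma frac_bits_sum: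
  "(\<And>i. frac_bits k (f i)) \<Longrightarrow> frac_bits (j * (k + 1) + 1) (\<Sum>i<j. f i)"
proof (induction j)
  case (Suc j)
  then show ?case
    using frac_bits_add[of k "f j" "j * (k + 1) + 1" "sum f {..<j}"] by (simp add: algebra_simps)
qed simp

lemma floorlog_le_self: "floorlog 2 v \<le> v"
  by (simp add: floorlog_le_iff)

lemma rat_size_le_imp_frac_bits:
  assumes "rat_size r \<le> k"
  shows "frac_bits k r"
proof -
  obtain a b where ab: "quotient_of r = (a, b)" by fastforce
  have b: "b > 0" using quotient_of_denom_pos[OF ab] .
  have "floorlog 2 (nat \<bar>a\<bar>) \<le> k" "floorlog 2 (nat \<bar>b\<bar>) \<le> k"
    using assms ab by (auto simp: rat_size_def int_size_def)
  then have "nat \<bar>a\<bar> < 2 ^ k" "nat \<bar>b\<bar> < 2 ^ k"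
    by (auto dest: floorlog_leD)
  then have "\<bar>a\<bar> < 2 ^ k" "b < 2 ^ k"
    using b by (auto simp: nat_less_iff)
  then show ?thesis unfolding frac_bits_def using b quotient_of_div[OF ab] by blast
qed

text \<open>Passing to lowest terms divides by the gcd and so increases neither absolute value. This
  leaves two numbers of at most \<open>k\<close> digits and two sign bits.\<close>

lemma frac_bits_imp_rat_size_le:
  assumes "frac_bits k r"
  shows "rat_size r \<le> 2 * k + 2"
proof -
  obtain c d where cd: "0 < d" "r = of_int c / of_int d" "\<bar>c\<bar> < 2 ^ k" "d < 2 ^ k"
    using assms unfolding frac_bits_def by auto
  have "quotient_of r = Rat.normalize (c, d)"
    using cd by (simp flip: Fract_of_int_quotient add: quotient_of_Fract)
  also have "\<dots> = (c div gcd c d, d div gcd c d)"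
    using cd by (simp add: Rat.normalize_def Let_def)
  finally have "rat_size r = 2 + floorlog 2 (nat \<bar>c div gcd c d\<bar>) + floorlog 2 (nat \<bar>d div gcd c d\<bar>)"
    by (simp add: rat_size_def int_size_def)
  moreover have "\<bar>a div g\<bar> \<le> \<bar>a\<bar>" if "g dvd a" for a g :: int
    using that dvd_imp_le_int[of a "a div g"] by (cases "a = 0") (auto elim: dvdE)
  then have "\<bar>c div gcd c d\<bar> \<le> \<bar>c\<bar>" "\<bar>d div gcd c d\<bar> \<le> \<bar>d\<bar>"
    by auto
  then have "floorlog 2 (nat \<bar>c div gcd c d\<bar>) \<le> k" "floorlog 2 (nat \<bar>d div gcd c d\<bar>) \<le> k"
    using cd by (auto simp: nat_less_iff intro!: floorlog_leI)
  ultimately show ?thesis by simp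
qed

section \<open>Polynomial time\<close>

lemma nth_concat_uniform:
  assumes "\<And>xs. xs \<in> set xss \<Longrightarrow> length xs = n" and "i < length xss" and "j < n"
  shows "concat xss ! (i * n + j) = xss ! i ! j"
  using assms
proof (induction xss arbitrary: i)
  case (Cons xs xss)
  then show ?case by (cases i) (auto simp: nth_append add.assoc)
qed simp

lemma length_concat_uniform:
  "(\<And>xs. xs \<in> set xss \<Longrightarrow> length xs = n) \<Longrightarrow> length (concat xss) = length xss * n"
  by (induction xss) auto

lemma ilcp_data_layout:
  assumes "M \<in> carrier_mat n n" "q \<in> carrier_vec n" "x0 \<in> carrier_vec n"
  shows "length (ilcp_data (n, M, q, x0)) = n * n + 2 * n"
    and "i < n \<Longrightarrow> j < n \<Longrightarrow> ilcp_data (n, M, q, x0) ! (i * n + j) = M $$ (i, j)"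
    and "i < n \<Longrightarrow> ilcp_data (n, M, q, x0) ! (n * n + i) = q $ i"
    and "i < n \<Longrightarrow> ilcp_data (n, M, q, x0) ! (n * n + n + i) = x0 $ i"
proof -
  let ?rows = "map list_of_vec (rows M)"
  have rows: "length xs = n" if "xs \<in> set ?rows" for xs
    using that assms by (auto simp: rows_def)
  have len: "length (concat ?rows) = n * n"
    using length_concat_uniform[of ?rows n] rows assms by (metis length_map length_rows carrier_matD(1))
  then show "length (ilcp_data (n, M, q, x0)) = n * n + 2 * n"
    using assms by (simp add: ilcp_data_def)
  show "ilcp_data (n, M, q, x0) ! (i * n + j) = M $$ (i, j)" if "i < n" "j < n"
  proof -
    have "i * n + n \<le> n * n" using that(1) by (rule row_end_le)
    moreover have "concat ?rows ! (i * n + j) = ?rows ! i ! j"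
      by (rule nth_concat_uniform) (use rows that assms in auto)
    ultimately show ?thesis
      using that assms len by (simp add: ilcp_data_def nth_append)
  qed
  show "i < n \<Longrightarrow> ilcp_data (n, M, q, x0) ! (n * n + i) = q $ i"
    "i < n \<Longrightarrow> ilcp_data (n, M, q, x0) ! (n * n + n + i) = x0 $ i"
    using assms len by (auto simp: ilcp_data_def nth_append)
qed

text \<open>As every entry has size at least 1, the number of entries is at most the input size, and
  bounds polynomial in \<open>n\<close> become polynomial in that size.\<close>

lemma length_le_sum_list_map:
  fixes f :: "'a \<Rightarrow> nat"
  shows "(\<And>y. 1 \<le> f y) \<Longrightarrow> length ys \<le> (\<Sum>y\<leftarrow>ys. f y)"
proof (induction ys)
  case (Cons y ys)
  then show ?case using add_mono[of 1 "f y" "length ys"] by simp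
qed simp

section \<open>Transfer from the field of the machine to the reals\<close>

lemma slack_shift_hom:
  fixes h :: "'a::linordered_field \<Rightarrow> real"
  assumes "field_hom h" and mono: "strict_mono h"
  shows "slack n (\<lambda>i j. h (A i j)) (\<lambda>i. h (q i)) (\<lambda>i. h (x i)) i = h (slack n A q x i)"
    and "shift n (\<lambda>i j. h (A i j)) (\<lambda>i. h (q i)) (\<lambda>i. h (x i)) i = h (shift n A q x i)"
proof -
  interpret h: field_hom h by fact
  have less: "h a < h c \<longleftrightarrow> a < c" for a c using mono by (rule strict_mono_less)
  have r: "residual n (\<lambda>i j. h (A i j)) (\<lambda>i. h (q i)) (\<lambda>i. h (x i)) i = h (residual n A q x i)"
    by (simp add: residual_def h.hom_add h.hom_sum h.hom_mult)
  \<comment> \<open>The case distinction in \<open>slack\<close> depends on signs, which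
    \<open>h\<close> preserves by strict monotonicity.\<close>
  show s: "slack n (\<lambda>i j. h (A i j)) (\<lambda>i. h (q i)) (\<lambda>i. h (x i)) i = h (slack n A q x i)"
    using less[of 0] less[of _ 0] by (auto simp: slack_def r)
  show "shift n (\<lambda>i j. h (A i j)) (\<lambda>i. h (q i)) (\<lambda>i. h (x i)) i = h (shift n A q x i)"
    by (simp add: shift_def r s h.hom_add h.hom_sum h.hom_mult h.hom_minus h.hom_div)
qed

lemma residual_cong:
  assumes "\<And>i j. i < n \<Longrightarrow> j < n \<Longrightarrow> A i j = A' i j" "\<And>i. i < n \<Longrightarrow> q i = q' i"
    "\<And>i. i < n \<Longrightarrow> x i = x' i" "i < n"
  shows "residual n A q x i = residual n A' q' x' i"
  using assms by (auto simp: residual_def)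

lemma slack_cong:
  assumes "\<And>i j. i < n \<Longrightarrow> j < n \<Longrightarrow> A i j = A' i j" "\<And>i. i < n \<Longrightarrow> q i = q' i"
    "\<And>i. i < n \<Longrightarrow> x i = x' i" "i < n"
  shows "slack n A q x i = slack n A' q' x' i"
  using residual_cong[of n A A' q q' x x' i] assms by (simp add: slack_def)

lemma shift_cong:
  assumes "\<And>i j. i < n \<Longrightarrow> j < n \<Longrightarrow> A i j = A' i j" "\<And>i. i < n \<Longrightarrow> q i = q' i"
    "\<And>i. i < n \<Longrightarrow> x i = x' i" "i < n"
  shows "shift n A q x i = shift n A' q' x' i"
  using residual_cong[of n A A' q q' x x' i] slack_cong[of n A A' q q' x x' i] assms
  by (simp add: shift_def)

text \<open>The closed form uses only field operations and comparisons, so it commutes with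
  \<open>h\<close>. The values computed in the smaller field are therefore optimal among all real
  points.\<close>

lemma ilcp_a_answerI:
  fixes h :: "'a::linordered_field \<Rightarrow> real"
  assumes h: "field_hom h" "strict_mono h"
    and inst: "(n, M, q, x0) \<in> ilcp_a_instances"
    and A_def: "A = (\<lambda>i j. M $$ (i, j))"
    and M': "\<And>i j. i < n \<Longrightarrow> j < n \<Longrightarrow> m (i * n + j) = A i j - shift n A (($) q) (($) x0) i * x0 $ j"
    and q': "\<And>i. i < n \<Longrightarrow> m (n * n + i) = q $ i - shift n A (($) q) (($) x0) i"
    and s: "\<And>i. i < n \<Longrightarrow> m (n * n + n + i) = slack n A (($) q) (($) x0) i"
  shows "ilcp_a_answer h (n, M, q, x0) m"
proof -
  interpret h: field_hom h by fact
  have carrier: "M \<in> carrier_mat n n" "q \<in> carrier_vec n" "x0 \<in> carrier_vec n" "0\<^sub>v n \<le> x0"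
    using inst by (auto simp: ilcp_a_instances_def)
  let ?M = "map_mat h M" and ?q = "map_vec h q" and ?x = "map_vec h x0"
  let ?A = "\<lambda>i j. ?M $$ (i, j)"
  have "h 0 \<le> h (x0 $ i)" if "i < n" for i
    using carrier that strict_mono_less_eq[OF h(2), of 0 "x0 $ i"] by (simp add: less_eq_vec_def)
  then have "0\<^sub>v n \<le> ?x"
    using carrier by (auto simp: less_eq_vec_def)
  then have opt: "ilcp_a_optimal n ?M ?q ?x
      (mat n n (\<lambda>(i, j). ?A i j - shift n ?A (($) ?q) (($) ?x) i * ?x $ j),
       vec n (\<lambda>i. ?q $ i - shift n ?A (($) ?q) (($) ?x) i), vec n (slack n ?A (($) ?q) (($) ?x)))"
    using carrier by (intro ilcp_a_optimal_projection) auto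
  have shift: "shift n ?A (($) ?q) (($) ?x) i = h (shift n A (($) q) (($) x0) i)" if "i < n" for i
    using carrier that slack_shift_hom(2)[OF h, of n A "($) q" "($) x0" i]
    by (subst shift_cong[where A' = "\<lambda>i j. h (A i j)" and q' = "\<lambda>i. h (q $ i)" and x' = "\<lambda>i. h (x0 $ i)"])
      (auto simp: A_def)
  have slack: "slack n ?A (($) ?q) (($) ?x) i = h (slack n A (($) q) (($) x0) i)" if "i < n" for i
    using carrier that slack_shift_hom(1)[OF h, of n A "($) q" "($) x0" i]
    by (subst slack_cong[where A' = "\<lambda>i j. h (A i j)" and q' = "\<lambda>i. h (q $ i)" and x' = "\<lambda>i. h (x0 $ i)"])
      (auto simp: A_def)
  have "ilcp_decode n (h \<circ> m) =
      (mat n n (\<lambda>(i, j). ?A i j - shift n ?A (($) ?q) (($) ?x) i * ?x $ j),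
       vec n (\<lambda>i. ?q $ i - shift n ?A (($) ?q) (($) ?x) i), vec n (slack n ?A (($) ?q) (($) ?x)))"
    unfolding ilcp_decode_def using carrier
    by (auto simp: shift slack M' q' s A_def h.hom_minus h.hom_mult intro!: eq_matI eq_vecI)
  with opt show ?thesis by (simp add: ilcp_a_answer_def)
qed

text \<open>Separates the number of steps, the same in both cost models, from the cost of a single
  step, for which \<open>pC\<close> is a polynomial bound.\<close>

lemma ilcp_a_solvable:
  fixes h :: "'a::linordered_field \<Rightarrow> real" and pC :: "nat poly"
  assumes h: "field_hom h" "strict_mono h" and sz: "\<And>a. 1 \<le> sz a"
    and run: "\<And>n M q x0. (n, M, q, x0) \<in> ilcp_a_instances \<Longrightarrow>
      \<exists>V. ilcp_run n (mem (init_config n (ilcp_data (n, M, q, x0)))) V cost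
        (poly pC (ilcp_size sz (n, M, q, x0)))"
  shows "solvable_in_poly_time cost ilcp_a_instances ilcp_encode (ilcp_size sz) (ilcp_a_answer h)"
  unfolding solvable_in_poly_time_def
\<comment> \<open>The program takes at most \<open>10 * n^2 + 24 * n + 12\<close> steps, and
  \<open>n^2 + 2 * n\<close> is at most the input size.\<close>
proof (rule exI[of _ ilcp_program], rule exI[of _ "[:12, 12:] * pC"], rule ballI)
  fix inst :: "'a ilcp_instance" assume "inst \<in> ilcp_a_instances"
  moreover obtain n M q x0 where inst: "inst = (n, M, q, x0)" by (cases inst) auto
  ultimately have mem: "(n, M, q, x0) \<in> ilcp_a_instances" by simp
  then have carrier: "M \<in> carrier_mat n n" "q \<in> carrier_vec n" "x0 \<in> carrier_vec n"
    by (auto simp: ilcp_a_instances_def)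
  define L where "L = ilcp_size sz (n, M, q, x0)"
  define m0 where "m0 = mem (init_config n (ilcp_data (n, M, q, x0)))"
  obtain V where "ilcp_run n m0 V cost (poly pC L)"
    using run[OF mem] unfolding m0_def L_def by blast
  then interpret ilcp_run n m0 V cost "poly pC L" "\<lambda>i j. m0 (i * n + j)" "\<lambda>i. m0 (n * n + i)" "\<lambda>j. m0 (n * n + n + j)"
    by simp_all
  note layout = ilcp_data_layout[OF carrier]
  have m0_M: "m0 (i * n + j) = M $$ (i, j)" if "i < n" "j < n" for i j
    using layout(1,2) row_end_le[OF that(1)] that by (simp add: m0_def init_config_def)
  have m0_q: "m0 (n * n + i) = q $ i" and m0_x: "m0 (n * n + n + i) = x0 $ i" if "i < n" for i
    using layout(1,3,4) that by (simp_all add: m0_def init_config_def)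
  have "n * n + 2 * n \<le> L"
    using length_le_sum_list_map[of sz "ilcp_data (n, M, q, x0)"] sz layout(1)
    by (simp add: L_def ilcp_size_def)
  then have time: "3 * n + 6 * n + n * (5 * n + 5 * n + 15) + 12 \<le> poly [:12, 12:] L"
    by (simp add: algebra_simps)
  obtain t c where exec: "exec cost ilcp_program \<lparr>pc = 0, idx = (\<lambda>_. 0)(0 := n), mem = m0\<rparr> t c"
    and t: "t \<le> (3 * n + 6 * n + n * (5 * n + 5 * n + 15) + 12) * poly pC L"
    and out: "\<And>i j. i < n \<Longrightarrow> j < n \<Longrightarrow> mem c (i * n + j) = m0 (i * n + j) - \<delta> i * m0 (n * n + n + j)"
      "\<And>i. i < n \<Longrightarrow> mem c (n * n + i) = m0 (n * n + i) - \<delta> i"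
      "\<And>i. i < n \<Longrightarrow> mem c (n * n + n + i) = \<sigma> i"
    by (rule ilcp_program_exec) blast
  have "\<delta> i = shift n (\<lambda>i j. M $$ (i, j)) (($) q) (($) x0) i"
    "\<sigma> i = slack n (\<lambda>i j. M $$ (i, j)) (($) q) (($) x0) i" if "i < n" for i
    using that by (auto intro!: shift_cong slack_cong m0_M m0_q m0_x)
  then have "ilcp_a_answer h (n, M, q, x0) (mem c)"
    by (intro ilcp_a_answerI[OF h mem refl]) (auto simp: out m0_M m0_q m0_x)
  moreover have "t \<le> poly ([:12, 12:] * pC) L"
    using t mult_le_mono1[OF time, of "poly pC L"] unfolding poly_mult by (rule order_trans)
  moreover have "\<lparr>pc = 0, idx = (\<lambda>_. 0)(0 := n), mem = m0\<rparr> = case_prod init_config (ilcp_encode inst)"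
    by (auto simp: m0_def ilcp_encode_def inst init_config_def)
  ultimately show "\<exists>t c. exec cost ilcp_program (case_prod init_config (ilcp_encode inst)) t c \<and>
      t \<le> poly ([:12, 12:] * pC) (ilcp_size sz inst) \<and> ilcp_a_answer h inst (mem c)"
    using exec unfolding L_def inst by auto
qed

section \<open>Logarithmic cost of the run on rational data\<close>

lemma log_cost_le:
  assumes "ins \<in> set ilcp_program" and "tame I (\<lambda>r. rat_size r \<le> K) c"
  shows "log_cost ins c \<le> 3 + 3 * I + 2 * K"
proof -
  have idx: "floorlog 2 (idx c k) \<le> I" and val: "rat_size (mem c a) \<le> K" for k a
    using assms(2) floorlog_le_self[of "idx c k"] le_trans unfolding tame_def by blast+
  have literal_idx: "v = 1" if "ins = SetI k v" for k v
    using assms(1) that by (auto simp: ilcp_program_def)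
  have literal: "v \<in> {0, 1}" if "ins = Const k v" for k v
    using assms(1) that by (auto simp: ilcp_program_def)
  \<comment> \<open>The 3 in the bound is the base charge 1 plus the largest literal length 2. No
    instruction is charged for more than three addresses and two operands.\<close>
  have lit: "floorlog 2 (Suc 0) \<le> 1" "int_size 0 \<le> 2" "int_size 1 \<le> 2"
    by (auto simp: int_size_def floorlog_le_iff)
  show ?thesis
  proof (cases ins)
    case (SetI k v)
    then show ?thesis using literal_idx[of k v] lit by simp
  next
    case (Const k v)
    then show ?thesis using literal[of k v] idx[of k] lit by auto
  next
    case (AddI k a b) then show ?thesis using idx[of a] idx[of b] by simp
  next
    case (SubI k a b) then show ?thesis using idx[of a] idx[of b] by simp
  next
    case (JumpLessI a b k) then show ?thesis using idx[of a] idx[of b] by simp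
  next
    case (Add k a b)
    then show ?thesis using idx[of a] idx[of b] idx[of k] val[of "idx c a"] val[of "idx c b"] by simp
  next
    case (Sub k a b)
    then show ?thesis using idx[of a] idx[of b] idx[of k] val[of "idx c a"] val[of "idx c b"] by simp
  next
    case (Mul k a b)
    then show ?thesis using idx[of a] idx[of b] idx[of k] val[of "idx c a"] val[of "idx c b"] by simp
  next
    case (Div k a b)
    then show ?thesis using idx[of a] idx[of b] idx[of k] val[of "idx c a"] val[of "idx c b"] by simp
  next
    case (JumpLess a b k)
    then show ?thesis using idx[of a] idx[of b] val[of "idx c a"] val[of "idx c b"] by simp
  qed
qed

lemma ilcp_run_rat:
  fixes m0 :: "nat \<Rightarrow> rat"
  assumes n: "0 < n" and L: "n * n + 2 * n \<le> L"
    and m0_outside: "\<And>a. n * n + 2 * n \<le> a \<Longrightarrow> m0 a = 0"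
    and bits_m0: "\<And>a. frac_bits L (m0 a)"
  shows "ilcp_run n m0 (\<lambda>r. rat_size r \<le> 2 * (6 * L * L + 11 * L + 13) + 2) log_cost (poly [:71, 50, 24:] L)"
proof -
  \<comment> \<open>\<open>E\<close> covers one number of length \<open>L\<close> plus at most
    \<open>n\<close> products of two such numbers, hence residuals and \<open>N\<close>. A shift
    then takes \<open>3 * E + 1\<close> bits, and a corrected matrix entry
    \<open>3 * E + 2 * L + 2\<close>, which \<open>K\<close> dominates.\<close>
  define K where "K = 6 * L * L + 11 * L + 13"
  define E where "E = 2 * L * L + 3 * L + 3"
  define A where "A = (\<lambda>i j. m0 (i * n + j))"
  define q where "q = (\<lambda>i. m0 (n * n + i))"
  define x where "x = (\<lambda>j. m0 (n * n + n + j))"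
  note defs = A_def q_def x_def
  have L_pos: "0 < L" and n_le: "n \<le> L" and K: "3 * E + 2 * L + 2 \<le> K" and E: "0 < E"
    using n L by (auto simp: K_def E_def)
  have bits: "frac_bits L (A i j)" "frac_bits L (q i)" "frac_bits L (x j)" for i j
    using bits_m0 by (simp_all add: defs)
  have small: "rat_size y \<le> 2 * K + 2" if "frac_bits k y" "k \<le> K" for k y
    using frac_bits_imp_rat_size_le[OF frac_bits_mono[OF that]] .
  have prod: "frac_bits (2 * L) (y * z)" if "frac_bits L y" "frac_bits L z" for y z
    using frac_bits_mult[OF that] by (simp add: mult_2)
  have sum: "frac_bits E (c + (\<Sum>l<j. f l))" if "\<And>l. frac_bits (2 * L) (f l)" "frac_bits L c" "j \<le> n" for j f c
  proof -
    have "j * (2 * L + 1) \<le> L * (2 * L + 1)" using that(3) n_le by (intro mult_le_mono1) simp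
    then have "L + (j * (2 * L + 1) + 1) + 1 \<le> E" by (simp add: E_def algebra_simps)
    moreover have "frac_bits (j * (2 * L + 1) + 1) (\<Sum>l<j. f l)"
      by (rule frac_bits_sum) (rule that(1))
    ultimately show ?thesis using frac_bits_mono[OF frac_bits_add[OF that(2)]] by blast
  qed
  have N: "frac_bits E (1 + (\<Sum>l<j. x l * x l))" if "j \<le> n" for j
    using sum[OF prod] bits L_pos that by simp
  have partial: "frac_bits E (q i + (\<Sum>l<j. A i l * x l))" if "j \<le> n" for i j
    using sum[OF prod] bits that by simp
  have slack: "frac_bits E (slack n A q x i)" for i
    using partial[of n i] E by (simp add: slack_def residual_def)
  have diff: "frac_bits (2 * E + 1) (residual n A q x i - slack n A q x i)" for i
    using frac_bits_diff[OF partial[of n i] slack[of i]] by (simp add: residual_def mult_2)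
  have shift: "frac_bits (3 * E + 1) (shift n A q x i)" for i
    using frac_bits_divide[OF diff[of i] N[of n] E] by (simp add: shift_def)
  have shift_prod: "frac_bits (3 * E + 1 + L) (shift n A q x i * x j)" for i j
    using frac_bits_mult[OF shift bits(3)] by simp
  have A': "frac_bits (3 * E + 2 * L + 2) (A i j - shift n A q x i * x j)" for i j
    using frac_bits_diff[OF bits(1) shift_prod] by (simp add: algebra_simps)
  have q': "frac_bits (3 * E + L + 2) (q i - shift n A q x i)" for i
    using frac_bits_diff[OF bits(2) shift] by (simp add: algebra_simps)
  \<comment> \<open>The value terms contribute \<open>24 * L^2 + 44 * L\<close>, and the address
    terms \<open>3 * n^2 + 9 * n\<close> are at most \<open>6 * L\<close>; the constants add up to
    71.\<close>
  have cost: "3 + 3 * (n * n + 3 * n + 4) + 2 * (2 * K + 2) \<le> poly [:71, 50, 24:] L"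
    using L by (simp add: K_def algebra_simps)
  have E_K: "2 * L \<le> K" "E \<le> K" "2 * E + 1 \<le> K" "3 * E + 1 \<le> K" "3 * E + 1 + L \<le> K" "3 * E + L + 2 \<le> K"
    using K by auto
  have sizes: "rat_size (x j * x j) \<le> 2 * K + 2" "j \<le> n \<Longrightarrow> rat_size (1 + (\<Sum>l<j. x l * x l)) \<le> 2 * K + 2"
    "rat_size (A i j * x j) \<le> 2 * K + 2" "j \<le> n \<Longrightarrow> rat_size (q i + (\<Sum>l<j. A i l * x l)) \<le> 2 * K + 2"
    "rat_size (residual n A q x i - slack n A q x i) \<le> 2 * K + 2" "rat_size (shift n A q x i) \<le> 2 * K + 2"
    "rat_size (shift n A q x i * x j) \<le> 2 * K + 2" "rat_size (A i j - shift n A q x i * x j) \<le> 2 * K + 2"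
    "rat_size (q i - shift n A q x i) \<le> 2 * K + 2" for i j
    using small[OF prod[OF bits(3) bits(3)] E_K(1)] small[OF N E_K(2)] small[OF prod[OF bits(1) bits(3)] E_K(1)]
      small[OF partial E_K(2)] small[OF diff E_K(3)] small[OF shift E_K(4)] small[OF shift_prod E_K(5)]
      small[OF A' K] small[OF q' E_K(6)]
    by blast+
  show ?thesis
    unfolding K_def[symmetric]
  proof unfold_locales
    show "log_cost ins c \<le> poly [:71, 50, 24:] L"
      if "ins \<in> set ilcp_program" "tame (n * n + 3 * n + 4) (\<lambda>r. rat_size r \<le> 2 * K + 2) c" for ins c
      using log_cost_le[OF that] cost by linarith
    show "rat_size 1 \<le> 2 * K + 2"
      by (rule small[of 1]) (auto simp: K_def)
    show "rat_size (m0 a) \<le> 2 * K + 2" for a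
      using E_K by (intro small[OF bits_m0]) simp
  qed (use n m0_outside sizes[unfolded defs] in \<open>simp_all del: One_nat_def\<close>)
qed

theorem theorem3p1:
  shows "solvable_in_poly_time log_cost
           (ilcp_a_instances :: rat ilcp_instance set)
           ilcp_encode (ilcp_size rat_size) (ilcp_a_answer of_rat)
       \<and> solvable_in_poly_time unit_cost
           (ilcp_a_instances :: real ilcp_instance set)
           ilcp_encode (ilcp_size (\<lambda>_. 1)) (ilcp_a_answer (\<lambda>a. a))"
proof
  have rat_size: "1 \<le> rat_size a" for a
    by (simp add: rat_size_def int_size_def split: prod.split)
  show "solvable_in_poly_time log_cost (ilcp_a_instances :: rat ilcp_instance set)
      ilcp_encode (ilcp_size rat_size) (ilcp_a_answer of_rat)"
  proof (rule ilcp_a_solvable[where pC = "[:71, 50, 24:]"])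
    show "field_hom (of_rat :: rat \<Rightarrow> real)" ..
    show "strict_mono (of_rat :: rat \<Rightarrow> real)" by (simp add: strict_mono_def of_rat_less)
    show "1 \<le> rat_size a" for a by (rule rat_size)
    fix n and M :: "rat mat" and q x0
    assume inst: "(n, M, q, x0) \<in> ilcp_a_instances"
    let ?xs = "ilcp_data (n, M, q, x0)" and ?L = "ilcp_size rat_size (n, M, q, x0)"
    have n: "0 < n" and len: "length ?xs = n * n + 2 * n"
      using inst ilcp_data_layout(1)[of M n q x0] by (auto simp: ilcp_a_instances_def)
    have L: "n * n + 2 * n \<le> ?L"
      using length_le_sum_list_map[of rat_size ?xs] rat_size len by (simp add: ilcp_size_def)
    have "frac_bits ?L y" if "y \<in> set ?xs" for y
      using that by (intro rat_size_le_imp_frac_bits) (auto simp: ilcp_size_def intro!: member_le_sum_list)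
    then have bits: "frac_bits ?L (mem (init_config n ?xs) a)" for a
      using n L by (auto simp: init_config_def)
    have "mem (init_config n ?xs) a = 0" if "n * n + 2 * n \<le> a" for a
      using that len by (simp add: init_config_def)
    from ilcp_run_rat[of n ?L "mem (init_config n ?xs)", OF n L this bits]
    show "\<exists>V. ilcp_run n (mem (init_config n ?xs)) V log_cost (poly [:71, 50, 24:] ?L)"
      by blast
  qed
  show "solvable_in_poly_time unit_cost (ilcp_a_instances :: real ilcp_instance set)
      ilcp_encode (ilcp_size (\<lambda>_. 1)) (ilcp_a_answer (\<lambda>a. a))"
  \<comment> \<open>A step costs 1 whatever the values are, so the bound per step is the constant
    polynomial 1.\<close>
  proof (rule ilcp_a_solvable[where pC = 1])
    show "field_hom (\<lambda>a::real. a)" by unfold_locales auto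
    show "strict_mono (\<lambda>a::real. a)" by (simp add: strict_mono_def)
    fix n and M :: "real mat" and q x0
    assume inst: "(n, M, q, x0) \<in> ilcp_a_instances"
    then have "0 < n" and "length (ilcp_data (n, M, q, x0)) = n * n + 2 * n"
      using ilcp_data_layout(1)[of M n q x0] by (auto simp: ilcp_a_instances_def)
    then show "\<exists>V. ilcp_run n (mem (init_config n (ilcp_data (n, M, q, x0)))) V unit_cost
        (poly 1 (ilcp_size (\<lambda>_. 1) (n, M, q, x0)))"
      by (intro exI[of _ "\<lambda>_. True"], unfold_locales) (auto simp: init_config_def unit_cost_def)
  qed simp
qed

end
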